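(* Every Garside group is biautomatic.
   Context: Let $M$ be a monoid. For $x,y\in M$, $x$ is a left divisor of $y$ (equivalently $y$ is a right multiple of $x$) if $xz=y$ for some $z\in M$; right divisors and left multiples are defined symmetrically. A right lcm of $x,y$ is a right multiple of both $x$ and $y$ that is a left divisor of every common right multiple of $x$ and $y$; a left gcd of $x,y$ is a common left divisor of $x$ and $y$ that is a right multiple of every common left divisor. Left lcm's and right gcd's are defined symmetrically. An atom of $M$ is an element $x\neq 1$ such that $x=yz$ implies $y=1$ or $z=1$. $M$ is atomic if it is generated by its atoms and, for every $x\in M$, the supremum $\|x\|$ of the lengths of the expressions of $x$ as a product of atoms is finite. $M$ is Gaussian if it is atomic, left and right cancellative, and any two elements of $M$ admit a right lcm, a left lcm, a right gcd and a left gcd. A Garside element in a Gaussian monoid $M$ is an element $\Delta$ such that the left divisors of $\Delta$ coincide with the right divisors of $\Delta$, they are finite in number, and they generate $M$. A Garside monoid is a Gaussian monoid that contains a Garside element. Every Gaussian monoid satisfies Ore's conditions, hence embeds in a group of fractions. A group is a Garside group if it is the group of fractions of some Garside monoid. "Biautomatic" has its standard meaning. *)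

theory Defs
  imports "HOL-Algebra.Algebra"
begin

section \<open>Divisibility, lcm's and gcd's in a monoid\<close>

definition left_divides :: "('m, 'c) monoid_scheme \<Rightarrow> 'm \<Rightarrow> 'm \<Rightarrow> bool" where
  "left_divides M x y \<longleftrightarrow> (\<exists>z \<in> carrier M. x \<otimes>\<^bsub>M\<^esub> z = y)"

definition right_divides :: "('m, 'c) monoid_scheme \<Rightarrow> 'm \<Rightarrow> 'm \<Rightarrow> bool" where
  "right_divides M x y \<longleftrightarrow> (\<exists>z \<in> carrier M. z \<otimes>\<^bsub>M\<^esub> x = y)"

definition is_right_lcm :: "('m, 'c) monoid_scheme \<Rightarrow> 'm \<Rightarrow> 'm \<Rightarrow> 'm \<Rightarrow> bool" where
  "is_right_lcm M x y m \<longleftrightarrow> m \<in> carrier M \<and> left_divides M x m \<and> left_divides M y m \<and>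
     (\<forall>n \<in> carrier M. left_divides M x n \<longrightarrow> left_divides M y n \<longrightarrow> left_divides M m n)"

definition is_left_lcm :: "('m, 'c) monoid_scheme \<Rightarrow> 'm \<Rightarrow> 'm \<Rightarrow> 'm \<Rightarrow> bool" where
  "is_left_lcm M x y m \<longleftrightarrow> m \<in> carrier M \<and> right_divides M x m \<and> right_divides M y m \<and>
     (\<forall>n \<in> carrier M. right_divides M x n \<longrightarrow> right_divides M y n \<longrightarrow> right_divides M m n)"

definition is_left_gcd :: "('m, 'c) monoid_scheme \<Rightarrow> 'm \<Rightarrow> 'm \<Rightarrow> 'm \<Rightarrow> bool" where
  "is_left_gcd M x y d \<longleftrightarrow> d \<in> carrier M \<and> left_divides M d x \<and> left_divides M d y \<and>
     (\<forall>e \<in> carrier M. left_divides M e x \<longrightarrow> left_divides M e y \<longrightarrow> left_divides M e d)"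

definition is_right_gcd :: "('m, 'c) monoid_scheme \<Rightarrow> 'm \<Rightarrow> 'm \<Rightarrow> 'm \<Rightarrow> bool" where
  "is_right_gcd M x y d \<longleftrightarrow> d \<in> carrier M \<and> right_divides M d x \<and> right_divides M d y \<and>
     (\<forall>e \<in> carrier M. right_divides M e x \<longrightarrow> right_divides M e y \<longrightarrow> right_divides M e d)"


section \<open>Gaussian and Garside monoids, Garside groups\<close>

definition word_val :: "('m, 'c) monoid_scheme \<Rightarrow> 'm list \<Rightarrow> 'm" where
  "word_val M w = foldr (\<otimes>\<^bsub>M\<^esub>) w \<one>\<^bsub>M\<^esub>"

definition generates_monoid :: "('m, 'c) monoid_scheme \<Rightarrow> 'm set \<Rightarrow> bool" where
  "generates_monoid M S \<longleftrightarrow> S \<subseteq> carrier M \<and> (\<forall>x \<in> carrier M. \<exists>w \<in> lists S. word_val M w = x)"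

definition atoms :: "('m, 'c) monoid_scheme \<Rightarrow> 'm set" where
  "atoms M = {x \<in> carrier M. x \<noteq> \<one>\<^bsub>M\<^esub> \<and>
     (\<forall>y \<in> carrier M. \<forall>z \<in> carrier M. x = y \<otimes>\<^bsub>M\<^esub> z \<longrightarrow> y = \<one>\<^bsub>M\<^esub> \<or> z = \<one>\<^bsub>M\<^esub>)}"

definition atomic_monoid :: "('m, 'c) monoid_scheme \<Rightarrow> bool" where
  "atomic_monoid M \<longleftrightarrow> monoid M \<and> generates_monoid M (atoms M) \<and>
     (\<forall>x \<in> carrier M. bdd_above (length ` {w \<in> lists (atoms M). word_val M w = x}))"

definition gaussian_monoid :: "('m, 'c) monoid_scheme \<Rightarrow> bool" where
  "gaussian_monoid M \<longleftrightarrow> atomic_monoid M \<and> monoid_cancel M \<and>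
     (\<forall>x \<in> carrier M. \<forall>y \<in> carrier M.
        (\<exists>m. is_right_lcm M x y m) \<and> (\<exists>m. is_left_lcm M x y m) \<and>
        (\<exists>d. is_right_gcd M x y d) \<and> (\<exists>d. is_left_gcd M x y d))"

definition garside_element :: "('m, 'c) monoid_scheme \<Rightarrow> 'm \<Rightarrow> bool" where
  "garside_element M \<Delta> \<longleftrightarrow> \<Delta> \<in> carrier M \<and>
     {x \<in> carrier M. left_divides M x \<Delta>} = {x \<in> carrier M. right_divides M x \<Delta>} \<and>
     finite {x \<in> carrier M. left_divides M x \<Delta>} \<and>
     generates_monoid M {x \<in> carrier M. left_divides M x \<Delta>}"

definition garside_monoid :: "('m, 'c) monoid_scheme \<Rightarrow> bool" where
  "garside_monoid M \<longleftrightarrow> gaussian_monoid M \<and> (\<exists>\<Delta>. garside_element M \<Delta>)"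

text \<open>Since a Gaussian monoid satisfies Ore's conditions on both sides, asking for left
  fractions or for right fractions describes the same group.\<close>

definition group_of_fractions :: "('m, 'c) monoid_scheme \<Rightarrow> ('g, 'd) monoid_scheme \<Rightarrow> bool" where
  "group_of_fractions M G \<longleftrightarrow> group G \<and>
     (\<exists>\<iota> \<in> hom M G. inj_on \<iota> (carrier M) \<and>
        (\<forall>g \<in> carrier G. \<exists>x \<in> carrier M. \<exists>y \<in> carrier M. g = inv\<^bsub>G\<^esub> (\<iota> x) \<otimes>\<^bsub>G\<^esub> \<iota> y))"

text \<open>A definition cannot quantify over types, so the type of the elements of the monoid
  is a parameter.\<close>

definition garside_group :: "'m itself \<Rightarrow> ('g, 'd) monoid_scheme \<Rightarrow> bool" where
  "garside_group _ G \<longleftrightarrow> (\<exists>M :: 'm monoid. garside_monoid M \<and> group_of_fractions M G)"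


section \<open>Regular languages and biautomatic groups\<close>

text \<open>Recognition by a deterministic finite automaton with states $0, \ldots, n-1$, initial state
  \<open>q\<^sub>0\<close>, transition function \<open>\<delta>\<close> and accepting states \<open>F\<close>.\<close>

definition regular_language :: "'a set \<Rightarrow> 'a list set \<Rightarrow> bool" where
  "regular_language A L \<longleftrightarrow> L \<subseteq> lists A \<and>
     (\<exists>(n :: nat) \<delta> q\<^sub>0 F. q\<^sub>0 < n \<and> F \<subseteq> {..<n} \<and> (\<forall>q<n. \<forall>a \<in> A. \<delta> q a < n) \<and>
        (\<forall>w \<in> lists A. w \<in> L \<longleftrightarrow> foldl \<delta> q\<^sub>0 w \<in> F))"

text \<open>A pair of words is read synchronously, letter by letter; the shorter word is padded at its
  end by the letter \<open>None\<close>.\<close>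

fun pad :: "'a list \<Rightarrow> 'a list \<Rightarrow> ('a option \<times> 'a option) list" where
  "pad [] [] = []"
| "pad (a # u) [] = (Some a, None) # pad u []"
| "pad [] (b # v) = (None, Some b) # pad [] v"
| "pad (a # u) (b # v) = (Some a, Some b) # pad u v"

definition pad_alphabet :: "'a set \<Rightarrow> ('a option \<times> 'a option) set" where
  "pad_alphabet A = (insert None (Some ` A) \<times> insert None (Some ` A)) - {(None, None)}"

definition right_multiplier ::
  "('g, 'd) monoid_scheme \<Rightarrow> 'g list set \<Rightarrow> 'g \<Rightarrow> ('g option \<times> 'g option) list set" where
  "right_multiplier G L a =
     {pad u v | u v. u \<in> L \<and> v \<in> L \<and> word_val G u \<otimes>\<^bsub>G\<^esub> a = word_val G v}"

definition left_multiplier ::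
  "('g, 'd) monoid_scheme \<Rightarrow> 'g list set \<Rightarrow> 'g \<Rightarrow> ('g option \<times> 'g option) list set" where
  "left_multiplier G L a =
     {pad u v | u v. u \<in> L \<and> v \<in> L \<and> a \<otimes>\<^bsub>G\<^esub> word_val G u = word_val G v}"

text \<open>The case \<open>a = \<one>\<close> is the equality recognizer.\<close>

definition biautomatic_structure ::
  "('g, 'd) monoid_scheme \<Rightarrow> 'g set \<Rightarrow> 'g list set \<Rightarrow> bool" where
  "biautomatic_structure G A L \<longleftrightarrow>
     finite A \<and> A \<subseteq> carrier G \<and> (\<forall>a \<in> A. inv\<^bsub>G\<^esub> a \<in> A) \<and> generates_monoid G A \<and>
     regular_language A L \<and> word_val G ` L = carrier G \<and>
     (\<forall>a \<in> insert \<one>\<^bsub>G\<^esub> A.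
        regular_language (pad_alphabet A) (right_multiplier G L a) \<and>
        regular_language (pad_alphabet A) (left_multiplier G L a))"

definition biautomatic :: "('g, 'd) monoid_scheme \<Rightarrow> bool" where
  "biautomatic G \<longleftrightarrow> group G \<and> (\<exists>A L. biautomatic_structure G A L)"

end

theory Submission
  imports Defs
begin

text \<open>
  Let \<open>G\<close> be the group of fractions of a Garside monoid with image \<open>P\<close> in \<open>G\<close>, and let \<open>\<Delta>\<close> be a
  Garside element. Left divisibility extends to the preorder \<open>x \<preceq> y \<longleftrightarrow> x\<inverse> y \<in> P\<close> on \<open>G\<close>. It is
  invariant under left translations and, since \<open>\<Delta>\<close> normalizes \<open>P\<close>, under right multiplication by
  powers of \<open>\<Delta>\<close>. Every element lies between two powers of \<open>\<Delta>\<close>, and every interval between two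
  powers of \<open>\<Delta>\<close> is finite.

  The language consists of the words \<open>\<Delta>\<^sup>-\<^sup>k s\<^sub>1 \<dots> s\<^sub>n\<close> with divisors \<open>s\<^sub>i\<close> of \<open>\<Delta>\<close> such that \<open>s\<^sub>i\<close> is the gcd
  of \<open>s\<^sub>i s\<^sub>i\<^sub>+\<^sub>1\<close> and \<open>\<Delta>\<close>, and such that \<open>\<Delta>\<close> does not divide \<open>s\<^sub>1\<close> if \<open>k > 0\<close>. The conditions concern
  consecutive letters only, so the language is regular. Every \<open>g\<close> has such an expression
  (\<open>normal_form_exists\<close>), and unless \<open>\<Delta>\<inverse>\<close> is positive, in which case \<open>G\<close> is finite, \<open>k\<close> is the
  least natural number with \<open>\<Delta>\<^sup>-\<^sup>k \<preceq> g\<close> and the prefix of length \<open>t\<close> has the value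
  \<open>(g \<sqinter> \<Delta>\<^sup>t\<^sup>-\<^sup>2\<^sup>k) \<squnion> \<Delta>\<^sup>-\<^sup>t\<close> (\<open>normal_form_prefix\<close>).

  Meets and joins are 1-Lipschitz with respect to \<open>x \<Delta>\<^sup>-\<^sup>N \<preceq> y \<preceq> x \<Delta>\<^sup>N\<close> (\<open>meet_close\<close>, \<open>join_close\<close>).
  If \<open>h = b g c\<close> with \<open>b\<close> and \<open>c\<close> between \<open>\<Delta>\<inverse>\<close> and \<open>\<Delta>\<close>, then \<open>b g\<close> is close to \<open>h\<close>, \<open>b \<Delta>\<^sup>m\<close> is close to
  \<open>\<Delta>\<^sup>m\<close>, and the exponents \<open>k\<close> of \<open>g\<close> and \<open>h\<close> differ by at most 2. So the prefixes of normal forms of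
  \<open>g\<close>, translated by \<open>b\<close>, and of \<open>h\<close> are uniformly close (\<open>fellow_traveller\<close>), and an automaton
  keeping track of the finitely many word differences recognizes both multiplier languages
  (\<open>regular_multiplier\<close>).
\<close>

section \<open>Regular languages\<close>

text \<open>A language is regular as soon as a deterministic automaton with an arbitrary finite set of
  states recognizes it; the states are then numbered.\<close>
lemma regular_languageI:
  assumes "finite S" "q0 \<in> S" and step: "\<And>q a. q \<in> S \<Longrightarrow> a \<in> A \<Longrightarrow> \<delta> q a \<in> S"
    and "L \<subseteq> lists A" and acc: "\<And>w. w \<in> lists A \<Longrightarrow> w \<in> L \<longleftrightarrow> foldl \<delta> q0 w \<in> F"
  shows "regular_language A L"
proof -
  obtain h where h: "bij_betw h S {0..<card S}"
    using ex_bij_betw_finite_nat[OF \<open>finite S\<close>] by blast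
  define g where "g = inv_into S h"
  have gh: "g (h q) = q" if "q \<in> S" for q
    using h that unfolding g_def by (simp add: bij_betw_def)
  have hS: "h q < card S" if "q \<in> S" for q
    using h that by (auto simp: bij_betw_def)
  have gS: "g i \<in> S" if "i < card S" for i
    using h that unfolding g_def by (simp add: bij_betw_def inv_into_into)
  define \<delta>' where "\<delta>' = (\<lambda>i a. h (\<delta> (g i) a))"
  have fold_S: "foldl \<delta> q w \<in> S" if "q \<in> S" "w \<in> lists A" for q w
    using that by (induction w arbitrary: q) (auto simp: step)
  have fold: "foldl \<delta>' (h q) w = h (foldl \<delta> q w)" if "q \<in> S" "w \<in> lists A" for q w
    using that by (induction w arbitrary: q) (auto simp: step \<delta>'_def gh)
  show ?thesis
    unfolding regular_language_def
  proof (intro conjI exI ballI allI impI)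
    show "L \<subseteq> lists A" by fact
    show "h q0 < card S" using hS \<open>q0 \<in> S\<close> .
    show "h ` (F \<inter> S) \<subseteq> {..<card S}" using hS by auto
    show "\<delta>' q a < card S" if "q < card S" "a \<in> A" for q a
      unfolding \<delta>'_def using that by (intro hS step gS)
    show "w \<in> L \<longleftrightarrow> foldl \<delta>' (h q0) w \<in> h ` (F \<inter> S)" if "w \<in> lists A" for w
    proof -
      let ?q = "foldl \<delta> q0 w"
      have q: "?q \<in> S" using fold_S \<open>q0 \<in> S\<close> that .
      have "?q \<in> F" if *: "h ?q \<in> h ` (F \<inter> S)"
      proof -
        obtain p where p: "h ?q = h p" "p \<in> F" "p \<in> S" using * by auto
        have "?q = g (h ?q)" using gh[OF q] by (rule sym)
        also have "\<dots> = p" unfolding p(1) by (rule gh[OF p(3)])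
        finally show ?thesis using p(2) by (simp only:)
      qed
      then have "h ?q \<in> h ` (F \<inter> S) \<longleftrightarrow> ?q \<in> F" using q by auto
      then show ?thesis using acc[OF that] fold[OF \<open>q0 \<in> S\<close> that] by simp
    qed
  qed
qed

lemma regular_languageE:
  assumes "regular_language A L"
  obtains n :: nat and d q0 F where "L \<subseteq> lists A" "q0 < n"
    "\<forall>q<n. \<forall>a\<in>A. d q a < n" "\<forall>w\<in>lists A. w \<in> L \<longleftrightarrow> foldl d q0 w \<in> F"
  using assms unfolding regular_language_def by (elim conjE exE) (rule that)

lemma regular_language_Int:
  assumes "regular_language A L1" "regular_language A L2"
  shows "regular_language A (L1 \<inter> L2)"
proof -
  obtain n1 d1 q1 F1 where 1: "L1 \<subseteq> lists A" "q1 < (n1::nat)"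
    "\<forall>q<n1. \<forall>a\<in>A. d1 q a < n1" "\<forall>w\<in>lists A. w \<in> L1 \<longleftrightarrow> foldl d1 q1 w \<in> F1"
    using assms(1) by (rule regular_languageE) (rule that)
  obtain n2 d2 q2 F2 where 2: "L2 \<subseteq> lists A" "q2 < (n2::nat)"
    "\<forall>q<n2. \<forall>a\<in>A. d2 q a < n2" "\<forall>w\<in>lists A. w \<in> L2 \<longleftrightarrow> foldl d2 q2 w \<in> F2"
    using assms(2) by (rule regular_languageE) (rule that)
  have fold: "foldl (\<lambda>(p, q) a. (d1 p a, d2 q a)) (p, q) w = (foldl d1 p w, foldl d2 q w)" for p q w
    by (induction w arbitrary: p q) auto
  show ?thesis
  proof (rule regular_languageI)
    show "finite ({..<n1} \<times> {..<n2})" by simp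
    show "(q1, q2) \<in> {..<n1} \<times> {..<n2}" using 1 2 by simp
    show "(\<lambda>(p, q) a. (d1 p a, d2 q a)) s a \<in> {..<n1} \<times> {..<n2}"
      if "s \<in> {..<n1} \<times> {..<n2}" "a \<in> A" for s a
      using that 1 2 by auto
    show "L1 \<inter> L2 \<subseteq> lists A" using 1(1) by (rule le_infI1)
    show "w \<in> L1 \<inter> L2 \<longleftrightarrow> foldl (\<lambda>(p, q) a. (d1 p a, d2 q a)) (q1, q2) w \<in> F1 \<times> F2"
      if "w \<in> lists A" for w
      using that 1 2 by (simp add: fold)
  qed
qed

text \<open>Preimage of a regular language under a letter-to-letter map that may erase letters
  (those sent to \<open>None\<close>).\<close>
lemma regular_language_map_filter:
  assumes "regular_language A L" and f: "\<And>x a. x \<in> B \<Longrightarrow> f x = Some a \<Longrightarrow> a \<in> A"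
  shows "regular_language B {w \<in> lists B. List.map_filter f w \<in> L}"
proof -
  obtain n d q0 F where d: "L \<subseteq> lists A" "q0 < (n::nat)"
    "\<forall>q<n. \<forall>a\<in>A. d q a < n" "\<forall>w\<in>lists A. w \<in> L \<longleftrightarrow> foldl d q0 w \<in> F"
    using assms(1) by (rule regular_languageE) (rule that)
  define d' where "d' = (\<lambda>q x. case f x of None \<Rightarrow> q | Some a \<Rightarrow> d q a)"
  have fold: "foldl d' q w = foldl d q (List.map_filter f w)" for q w
    by (induction w arbitrary: q) (auto simp: d'_def split: option.splits)
  have listsA: "List.map_filter f w \<in> lists A" if "w \<in> lists B" for w
    using that f by (induction w) (auto simp: split: option.splits)
  show ?thesis
  proof (rule regular_languageI)
    show "finite {..<n}" "q0 \<in> {..<n}" using d by auto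
    show "d' q x \<in> {..<n}" if "q \<in> {..<n}" "x \<in> B" for q x
      using that d f by (auto simp: d'_def split: option.splits)
    show "{w \<in> lists B. List.map_filter f w \<in> L} \<subseteq> lists B" by blast
    show "w \<in> {w \<in> lists B. List.map_filter f w \<in> L} \<longleftrightarrow> foldl d' q0 w \<in> F"
      if "w \<in> lists B" for w
      using that bspec[OF d(4) listsA[OF that]] fold by (simp del: in_lists_conv_set)
  qed
qed

text \<open>A letter-driven walk whose positions all stay in a finite set \<open>F\<close> can be followed by an
  automaton with state set \<open>F\<close> and one dead state.\<close>
lemma regular_language_bounded_walk:
  assumes "finite F" "h0 \<in> F"
  shows "regular_language A
           {w \<in> lists A. (\<forall>t. foldl step h0 (take t w) \<in> F) \<and> foldl step h0 w = h1}"
proof -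
  define d where "d = (\<lambda>s x. case s of None \<Rightarrow> None
    | Some h \<Rightarrow> if step h x \<in> F then Some (step h x) else None)"
  have dead: "foldl d None w = None" for w
    by (induction w) (auto simp: d_def)
  have all_take: "(\<forall>t. Q (take t (x # w))) \<longleftrightarrow> Q [] \<and> (\<forall>t. Q (x # take t w))" for Q x w
  proof
    assume *: "\<forall>t. Q (take t (x # w))"
    show "Q [] \<and> (\<forall>t. Q (x # take t w))"
      using spec[OF *, of 0] spec[OF *, of "Suc _"] by auto
  next
    assume *: "Q [] \<and> (\<forall>t. Q (x # take t w))"
    show "\<forall>t. Q (take t (x # w))"
    proof
      show "Q (take t (x # w))" for t using * by (cases t) auto
    qed
  qed
  have fold: "foldl d (Some h) w =
      (if \<forall>t. foldl step h (take t w) \<in> F then Some (foldl step h w) else None)"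
    if "h \<in> F" for h w
    using that
  proof (induction w arbitrary: h)
    case Nil
    then show ?case by simp
  next
    case (Cons x w)
    have "(\<forall>t. foldl step h (take t (x # w)) \<in> F) \<longleftrightarrow>
        (\<forall>t. foldl step (step h x) (take t w) \<in> F)"
      using all_take[of "\<lambda>v. foldl step h v \<in> F" x w] Cons.prems by simp
    moreover have "step h x \<in> F" if "\<forall>t. foldl step (step h x) (take t w) \<in> F"
      using spec[OF that, of 0] by simp
    ultimately show ?case
      using Cons.IH[of "step h x"] dead by (auto simp: d_def)
  qed
  show ?thesis
  proof (rule regular_languageI)
    show "finite (insert None (Some ` F))" "Some h0 \<in> insert None (Some ` F)"
      using assms by auto
    show "d q a \<in> insert None (Some ` F)" if "q \<in> insert None (Some ` F)" for q a
      using that by (auto simp: d_def)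
    show "w \<in> {w \<in> lists A. (\<forall>t. foldl step h0 (take t w) \<in> F) \<and> foldl step h0 w = h1}
        \<longleftrightarrow> foldl d (Some h0) w \<in> {Some h1}" if "w \<in> lists A" for w
      using that by (auto simp: fold[OF \<open>h0 \<in> F\<close>])
  qed auto
qed

lemma regular_language_successively:
  assumes "finite A" "B \<subseteq> A"
  shows "regular_language A {w \<in> lists B. successively R w}"
proof -
  \<comment> \<open>State \<open>None\<close> is dead, \<open>Some None\<close> is initial, \<open>Some (Some x)\<close> records the last letter.\<close>
  define d where "d = (\<lambda>s y. case s of None \<Rightarrow> None
    | Some p \<Rightarrow> if y \<in> B \<and> (\<forall>x. p = Some x \<longrightarrow> R x y) then Some (Some y) else None)"
  have d_None: "d None y = None" for y by (simp add: d_def)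
  have d_Some: "d (Some (Some x)) y = (if y \<in> B \<and> R x y then Some (Some y) else None)" for x y
    by (simp add: d_def)
  have d_init: "d (Some None) y = (if y \<in> B then Some (Some y) else None)" for y
    by (simp add: d_def)
  have dead: "foldl d None w = None" for w
    by (induction w) (simp_all add: d_None)
  have fold: "foldl d (Some (Some x)) w \<noteq> None \<longleftrightarrow> w \<in> lists B \<and> successively R (x # w)" for x w
    by (induction w arbitrary: x) (auto simp: d_Some dead simp del: not_None_eq)
  have fold': "foldl d (Some None) w \<noteq> None \<longleftrightarrow> w \<in> lists B \<and> successively R w" for w
  proof (cases w)
    case (Cons x v)
    then show ?thesis using fold[of x v] dead by (simp add: d_init)
  qed auto
  show ?thesis
  proof (rule regular_languageI)
    show "finite (insert None (insert (Some None) (Some ` Some ` A)))" using assms by simp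
    show "Some None \<in> insert None (insert (Some None) (Some ` Some ` A))" by simp
    show "d q y \<in> insert None (insert (Some None) (Some ` Some ` A))"
      if "y \<in> A" for q y
      using that by (auto simp: d_def split: option.splits)
    show "w \<in> {w \<in> lists B. successively R w} \<longleftrightarrow> foldl d (Some None) w \<in> - {None}" for w
      using fold'[of w] by auto
  qed (use assms in auto)
qed

section \<open>Padded pairs of words\<close>

text \<open>Consecutive letters of a padded pair: once a component has ended (letter \<open>None\<close>), it stays
  ended. Among words without the letter \<open>(None, None)\<close> this local condition characterizes the
  range of \<open>pad\<close>.\<close>
definition end_closed :: "'a option \<times> 'b option \<Rightarrow> 'a option \<times> 'b option \<Rightarrow> bool" where
  "end_closed p q \<longleftrightarrow> (fst p = None \<longrightarrow> fst q = None) \<and> (snd p = None \<longrightarrow> snd q = None)"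

lemma successively_pad: "successively end_closed (pad u v)"
proof (induction u v rule: pad.induct)
  case (2 a u)
  then show ?case by (cases u) (auto simp: end_closed_def)
next
  case (3 b v)
  then show ?case by (cases v) (auto simp: end_closed_def)
next
  case (4 a u b v)
  then show ?case by (cases u; cases v) (auto simp: end_closed_def)
qed auto

lemma map_filter_pad:
  "List.map_filter fst (pad u v) = u" "List.map_filter snd (pad u v) = v"
  by (induction u v rule: pad.induct) auto

lemma take_pad: "take t (pad u v) = pad (take t u) (take t v)"
proof (induction u v arbitrary: t rule: pad.induct)
  case (2 a u)
  then show ?case by (cases t) auto
next
  case (3 b v)
  then show ?case by (cases t) auto
next
  case (4 a u b v)
  then show ?case by (cases t) auto
qed auto

lemma pad_in_lists: "u \<in> lists A \<Longrightarrow> v \<in> lists A \<Longrightarrow> pad u v \<in> lists (pad_alphabet A)"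
  by (induction u v rule: pad.induct) (auto simp: pad_alphabet_def)

lemma pad_map_filter:
  assumes "successively end_closed x" "(None, None) \<notin> set x"
  shows "pad (List.map_filter fst x) (List.map_filter snd x) = x"
  using assms
proof (induction x)
  case Nil
  then show ?case by simp
next
  case (Cons p x)
  have x: "successively end_closed x" "(None, None) \<notin> set x"
    using Cons.prems by (auto simp: successively_Cons)
  have none1: "List.map_filter fst x = []" if "fst p = None"
    using Cons.prems(1) that
  proof (induction x arbitrary: p)
    case (Cons q x)
    have "fst q = None" "successively end_closed (q # x)"
      using Cons.prems by (auto simp: end_closed_def)
    then show ?case using Cons.IH by simp
  qed simp
  have none2: "List.map_filter snd x = []" if "snd p = None"
    using Cons.prems(1) that
  proof (induction x arbitrary: p)
    case (Cons q x)
    have "snd q = None" "successively end_closed (q # x)"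
      using Cons.prems by (auto simp: end_closed_def)
    then show ?case using Cons.IH by simp
  qed simp
  obtain a b where p: "p = (a, b)" by (cases p)
  show ?case
    using Cons.IH[OF x] none1 none2 Cons.prems(2) unfolding p
    by (cases a; cases b) auto
qed

section \<open>The fellow traveller criterion\<close>

lemma (in monoid) word_val_closed: "w \<in> lists (carrier G) \<Longrightarrow> word_val G w \<in> carrier G"
  by (induction w) (auto simp: word_val_def)

lemma word_val_Nil [simp]: "word_val G [] = \<one>\<^bsub>G\<^esub>"
  and word_val_Cons [simp]: "word_val G (a # w) = a \<otimes>\<^bsub>G\<^esub> word_val G w"
  by (simp_all add: word_val_def)

lemma (in monoid) word_val_append:
  "u \<in> lists (carrier G) \<Longrightarrow> v \<in> lists (carrier G) \<Longrightarrow>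
   word_val G (u @ v) = word_val G u \<otimes> word_val G v"
  by (induction u) (auto simp: word_val_closed m_assoc)

context group
begin

text \<open>The element of the group read off one component of a padded letter; the padding letter
  \<open>None\<close> counts as the identity.\<close>
definition letter_val :: "'a option \<Rightarrow> 'a" where
  "letter_val x = (case x of None \<Rightarrow> \<one> | Some a \<Rightarrow> a)"

text \<open>Reading a padded letter \<open>(a, b)\<close> changes the word difference \<open>h\<close> into \<open>a\<inverse> h b\<close>.\<close>
definition diff_step :: "'a \<Rightarrow> 'a option \<times> 'a option \<Rightarrow> 'a" where
  "diff_step h p = inv (letter_val (fst p)) \<otimes> h \<otimes> letter_val (snd p)"

lemma foldl_diff_step_pad:
  assumes "u \<in> lists (carrier G)" "v \<in> lists (carrier G)" "h \<in> carrier G"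
  shows "foldl diff_step h (pad u v) = inv (word_val G u) \<otimes> h \<otimes> word_val G v"
  using assms
proof (induction u v arbitrary: h rule: pad.induct)
  case 1
  then show ?case by simp
next
  case (2 a u)
  then have c: "a \<in> carrier G" "word_val G u \<in> carrier G" by (auto simp: word_val_closed)
  with 2 show ?case
    by (simp add: diff_step_def letter_val_def inv_mult_group m_assoc)
next
  case (3 b v)
  then have c: "b \<in> carrier G" "word_val G v \<in> carrier G" by (auto simp: word_val_closed)
  with 3 show ?case
    by (simp add: diff_step_def letter_val_def m_assoc)
next
  case (4 a u b v)
  then have c: "a \<in> carrier G" "b \<in> carrier G" "word_val G u \<in> carrier G" "word_val G v \<in> carrier G"
    by (auto simp: word_val_closed)
  with 4 show ?case
    by (simp add: diff_step_def letter_val_def inv_mult_group m_assoc)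
qed

text \<open>The fellow traveller criterion. If the word differences \<open>u(t)\<inverse> b\<inverse> v(t)\<close> of pairs in
  \<open>L\<close> with \<open>b u c = v\<close> stay in a finite set, then the set of padded pairs is the intersection of
  four regular languages: well-formed paddings, first component in \<open>L\<close>, second component in \<open>L\<close>,
  and a bounded walk of the word difference from \<open>b\<inverse>\<close> to \<open>c\<close>. The right multiplier language is
  the case \<open>b = 1\<close>, the left one the case \<open>c = 1\<close>.\<close>
lemma regular_multiplier:
  assumes A: "finite A" "A \<subseteq> carrier G" and L: "regular_language A L" and F: "finite F"
    and b: "b \<in> carrier G" and c: "c \<in> carrier G"
    and fellow: "\<And>u v t. u \<in> L \<Longrightarrow> v \<in> L \<Longrightarrow> b \<otimes> word_val G u \<otimes> c = word_val G v \<Longrightarrow>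
      inv (word_val G (take t u)) \<otimes> inv b \<otimes> word_val G (take t v) \<in> F"
  shows "regular_language (pad_alphabet A)
    {pad u v | u v. u \<in> L \<and> v \<in> L \<and> b \<otimes> word_val G u \<otimes> c = word_val G v}"
    (is "regular_language ?B ?X")
proof -
  \<comment> \<open>The start of the walk need not lie in \<open>F\<close> if there is no pair at all.\<close>
  define F' where "F' = insert (inv b) F"
  define W where "W = {w \<in> lists ?B. (\<forall>t. foldl diff_step (inv b) (take t w) \<in> F') \<and>
    foldl diff_step (inv b) w = c}"
  define Y where "Y = {w \<in> lists ?B. successively end_closed w} \<inter>
    {w \<in> lists ?B. List.map_filter fst w \<in> L} \<inter> {w \<in> lists ?B. List.map_filter snd w \<in> L} \<inter> W"
  have LA: "L \<subseteq> lists A" using L by (simp add: regular_language_def)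
  have LG: "u \<in> lists (carrier G)" if "u \<in> L" for u
    using that LA A by auto
  have takeG: "take t u \<in> lists (carrier G)" if "u \<in> L" for t u
    using LG[OF that] by (auto dest: in_set_takeD)
  have eq_iff: "b \<otimes> word_val G u \<otimes> c = word_val G v \<longleftrightarrow>
      inv (word_val G u) \<otimes> inv b \<otimes> word_val G v = c" if "u \<in> L" "v \<in> L" for u v
  proof -
    have "word_val G u \<in> carrier G" "word_val G v \<in> carrier G"
      using that LG word_val_closed by auto
    then show ?thesis using b c
      by (metis inv_closed inv_mult_group inv_solve_left' m_closed)
  qed
  have "?X = Y"
  proof (intro equalityI subsetI)
    fix x assume "x \<in> ?X"
    then obtain u v where uv: "x = pad u v" "u \<in> L" "v \<in> L"
      "b \<otimes> word_val G u \<otimes> c = word_val G v" by blast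
    have x: "x \<in> lists ?B"
      unfolding uv(1) using LA uv(2,3) by (intro pad_in_lists subsetD[OF LA])
    have "foldl diff_step (inv b) x = inv (word_val G u) \<otimes> inv b \<otimes> word_val G v"
      unfolding uv(1) using foldl_diff_step_pad[OF LG[OF uv(2)] LG[OF uv(3)]] b by blast
    then have end_c: "foldl diff_step (inv b) x = c"
      using eq_iff[OF uv(2,3)] uv(4) by simp
    have in_F: "foldl diff_step (inv b) (take t x) \<in> F'" for t
    proof -
      have "foldl diff_step (inv b) (take t x) =
          inv (word_val G (take t u)) \<otimes> inv b \<otimes> word_val G (take t v)"
        unfolding uv(1) take_pad
        using foldl_diff_step_pad[OF takeG[OF uv(2)] takeG[OF uv(3)]] b by blast
      then show ?thesis using fellow[OF uv(2-4), of t] by (simp add: F'_def)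
    qed
    have "x \<in> W" using x end_c in_F unfolding W_def by blast
    then show "x \<in> Y"
      using x uv(2,3) successively_pad[of u v] unfolding Y_def uv(1)
      by (simp add: map_filter_pad del: in_lists_conv_set)
  next
    fix x assume x: "x \<in> Y"
    define u v where "u = List.map_filter fst x" and "v = List.map_filter snd x"
    have "(None, None) \<notin> set x" using x by (auto simp: Y_def pad_alphabet_def)
    then have pad: "x = pad u v"
      using x pad_map_filter[of x] by (simp add: Y_def u_def v_def)
    have uv: "u \<in> L" "v \<in> L" using x by (auto simp: Y_def u_def v_def)
    have "foldl diff_step (inv b) x = c" using x by (simp add: Y_def W_def)
    then have "b \<otimes> word_val G u \<otimes> c = word_val G v"
      using eq_iff[OF uv] foldl_diff_step_pad[OF LG[OF uv(1)] LG[OF uv(2)], of "inv b"] b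
      unfolding pad by simp
    then show "x \<in> ?X" using pad uv by blast
  qed
  moreover have "regular_language ?B Y"
    unfolding Y_def W_def
  proof (intro regular_language_Int)
    show "regular_language ?B {w \<in> lists ?B. successively end_closed w}"
      using A by (intro regular_language_successively) (auto simp: pad_alphabet_def)
    show "regular_language ?B {w \<in> lists ?B. List.map_filter fst w \<in> L}"
      "regular_language ?B {w \<in> lists ?B. List.map_filter snd w \<in> L}"
      by (intro regular_language_map_filter[OF L]; force simp: pad_alphabet_def)+
    show "regular_language ?B {w \<in> lists ?B. (\<forall>t. foldl diff_step (inv b) (take t w) \<in> F') \<and>
        foldl diff_step (inv b) w = c}"
      using F by (intro regular_language_bounded_walk) (auto simp: F'_def)
  qed
  ultimately show ?thesis by simp
qed

end

section \<open>The left divisibility order on a group of fractions\<close>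

context group
begin

lemma inv_mult_cancel: "x \<in> carrier G \<Longrightarrow> y \<in> carrier G \<Longrightarrow> inv x \<otimes> (x \<otimes> y) = y"
  and mult_inv_cancel: "x \<in> carrier G \<Longrightarrow> y \<in> carrier G \<Longrightarrow> x \<otimes> (inv x \<otimes> y) = y"
  by (simp_all flip: m_assoc)

lemmas group_word_simps = m_assoc inv_mult_group inv_mult_cancel mult_inv_cancel

end

text \<open>What is needed of a group of fractions of a Garside monoid, stated inside the group:
  \<open>P\<close> is the image of the monoid and \<open>\<Delta>\<close> that of the Garside element. The monoid
  \<open>P\<close> is allowed to contain nontrivial units.\<close>
locale garside_cone = group G for G (structure) +
  fixes P :: "'a set" and \<Delta> :: 'a
  assumes P_carrier: "P \<subseteq> carrier G"
    and one_P: "\<one> \<in> P"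
    and mult_P: "x \<in> P \<Longrightarrow> y \<in> P \<Longrightarrow> x \<otimes> y \<in> P"
    and Delta_P: "\<Delta> \<in> P"
    and conj_P: "x \<in> P \<Longrightarrow> inv \<Delta> \<otimes> x \<otimes> \<Delta> \<in> P"
    and conj_P': "x \<in> P \<Longrightarrow> \<Delta> \<otimes> x \<otimes> inv \<Delta> \<in> P"
    and finite_divisors: "finite {s \<in> P. inv s \<otimes> \<Delta> \<in> P}"
    and generated: "x \<in> P \<Longrightarrow> \<exists>w \<in> lists {s \<in> P. inv s \<otimes> \<Delta> \<in> P}. word_val G w = x"
    and fractions: "g \<in> carrier G \<Longrightarrow> \<exists>x \<in> P. \<exists>y \<in> P. g = inv x \<otimes> y"
    and gcd_P: "x \<in> P \<Longrightarrow> y \<in> P \<Longrightarrow> \<exists>d \<in> P. inv d \<otimes> x \<in> P \<and> inv d \<otimes> y \<in> P \<and>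
      (\<forall>e \<in> P. inv e \<otimes> x \<in> P \<longrightarrow> inv e \<otimes> y \<in> P \<longrightarrow> inv e \<otimes> d \<in> P)"
begin

text \<open>Left divisibility, extended to the whole group. It is invariant under left multiplication and,
  because \<open>P\<close> is normalized by \<open>\<Delta>\<close>, under right multiplication by powers of \<open>\<Delta>\<close>. It is only a
  preorder if \<open>P\<close> contains nontrivial units. Membership in the carrier is part of the definition.\<close>
definition le :: "'a \<Rightarrow> 'a \<Rightarrow> bool" (infix "\<preceq>" 50) where
  "x \<preceq> y \<longleftrightarrow> x \<in> carrier G \<and> y \<in> carrier G \<and> inv x \<otimes> y \<in> P"

abbreviation D :: "int \<Rightarrow> 'a" where
  "D m \<equiv> \<Delta> [^] m"

lemma Delta_closed [simp]: "\<Delta> \<in> carrier G"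
  using Delta_P P_carrier by blast

lemma leD: "x \<preceq> y \<Longrightarrow> x \<in> carrier G" "x \<preceq> y \<Longrightarrow> y \<in> carrier G"
  by (auto simp: le_def)

lemma le_refl: "x \<in> carrier G \<Longrightarrow> x \<preceq> x"
  by (simp add: le_def one_P)

lemma le_trans [trans]:
  assumes "x \<preceq> y" "y \<preceq> z"
  shows "x \<preceq> z"
proof -
  have "(inv x \<otimes> y) \<otimes> (inv y \<otimes> z) \<in> P"
    using assms mult_P by (simp add: le_def)
  moreover have "(inv x \<otimes> y) \<otimes> (inv y \<otimes> z) = inv x \<otimes> z"
    using assms by (simp add: le_def group_word_simps)
  ultimately show ?thesis using assms by (simp add: le_def)
qed

lemma one_le_iff: "\<one> \<preceq> x \<longleftrightarrow> x \<in> P"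
  using P_carrier by (auto simp: le_def)

lemma le_mult_left: "z \<in> carrier G \<Longrightarrow> x \<preceq> y \<Longrightarrow> z \<otimes> x \<preceq> z \<otimes> y"
  by (simp add: le_def group_word_simps)

lemma mult_le_iff:
  "z \<in> carrier G \<Longrightarrow> x \<in> carrier G \<Longrightarrow> y \<in> carrier G \<Longrightarrow> z \<otimes> x \<preceq> z \<otimes> y \<longleftrightarrow> x \<preceq> y"
  by (simp add: le_def group_word_simps)

lemma inv_mult_le_iff:
  "z \<in> carrier G \<Longrightarrow> x \<in> carrier G \<Longrightarrow> y \<in> carrier G \<Longrightarrow> inv z \<otimes> x \<preceq> y \<longleftrightarrow> x \<preceq> z \<otimes> y"
  using mult_le_iff[of z "inv z \<otimes> x" y] by (simp add: group_word_simps)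

lemma le_mult_P: "x \<in> carrier G \<Longrightarrow> \<one> \<preceq> p \<Longrightarrow> x \<preceq> x \<otimes> p"
  using le_mult_left[of x \<one> p] by simp

lemma D_add: "D (m + n) = D m \<otimes> D n"
  by (simp add: int_pow_mult)

lemma D_1: "D 1 = \<Delta>" and D_neg_1: "D (- 1) = inv \<Delta>" and inv_D: "inv (D m) = D (- m)"
  by (simp_all add: int_pow_neg)

lemma mult_D_D: "x \<in> carrier G \<Longrightarrow> x \<otimes> D m \<otimes> D n = x \<otimes> D (m + n)"
  by (simp add: D_add m_assoc)

lemma conj_D:
  assumes "x \<in> P"
  shows "inv (D m) \<otimes> x \<otimes> D m \<in> P"
proof (induction m rule: int_induct[where k = 0])
  case base
  then show ?case using assms P_carrier by auto
next
  case (step1 i)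
  have "inv (D (i + 1)) \<otimes> x \<otimes> D (i + 1) = inv \<Delta> \<otimes> (inv (D i) \<otimes> x \<otimes> D i) \<otimes> \<Delta>"
    using assms P_carrier by (subst (1 2) D_add) (auto simp: group_word_simps D_1)
  then show ?case using conj_P[OF step1(2)] by simp
next
  case (step2 i)
  have eq: "D (i - 1) = D i \<otimes> inv \<Delta>"
    using D_add[of i "- 1"] by (simp add: D_neg_1)
  have "inv (D (i - 1)) \<otimes> x \<otimes> D (i - 1) = \<Delta> \<otimes> (inv (D i) \<otimes> x \<otimes> D i) \<otimes> inv \<Delta>"
    using assms P_carrier unfolding eq by (auto simp: group_word_simps)
  then show ?case using conj_P'[OF step2(2)] by simp
qed

lemma le_mult_D:
  assumes "x \<preceq> y"
  shows "x \<otimes> D m \<preceq> y \<otimes> D m"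
proof -
  have "inv (x \<otimes> D m) \<otimes> (y \<otimes> D m) = inv (D m) \<otimes> (inv x \<otimes> y) \<otimes> D m"
    using assms by (simp add: le_def group_word_simps)
  then show ?thesis using assms conj_D[of "inv x \<otimes> y" m] by (simp add: le_def)
qed

lemma mult_D_le_iff:
  assumes "x \<in> carrier G" "y \<in> carrier G"
  shows "x \<otimes> D m \<preceq> y \<longleftrightarrow> x \<preceq> y \<otimes> D (- m)"
proof
  assume "x \<otimes> D m \<preceq> y"
  from le_mult_D[OF this, of "- m"] show "x \<preceq> y \<otimes> D (- m)"
    using assms by (simp add: mult_D_D)
next
  assume "x \<preceq> y \<otimes> D (- m)"
  from le_mult_D[OF this, of m] show "x \<otimes> D m \<preceq> y"
    using assms by (simp add: mult_D_D)
qed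

lemma D_nonneg: "0 \<le> m \<Longrightarrow> \<one> \<preceq> D m"
proof (induction m rule: int_ge_induct)
  case base
  then show ?case by (simp add: le_refl)
next
  case (step i)
  then show ?case using mult_P Delta_P by (simp add: D_add one_le_iff)
qed

lemma le_mult_D_nonneg: "x \<in> carrier G \<Longrightarrow> 0 \<le> m \<Longrightarrow> x \<preceq> x \<otimes> D m"
  using le_mult_P D_nonneg by blast

lemma D_mono: "m \<le> n \<Longrightarrow> D m \<preceq> D n"
  using le_mult_D_nonneg[of "D m" "n - m"] by (simp flip: D_add)

text \<open>A product of \<open>n\<close> divisors of \<open>\<Delta>\<close> divides \<open>\<Delta>\<^sup>n\<close>.\<close>
lemma P_le_D:
  assumes "x \<in> P"
  shows "\<exists>n::nat. x \<preceq> D (int n)"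
proof -
  have "\<exists>n::nat. word_val G w \<preceq> D (int n)" if "w \<in> lists {s \<in> P. inv s \<otimes> \<Delta> \<in> P}" for w
    using that
  proof (induction w)
    case Nil
    then show ?case using le_refl[of \<one>] by (intro exI[of _ 0]) simp
  next
    case (Cons s w)
    then obtain n where n: "word_val G w \<preceq> D (int n)" by auto
    have s: "s \<in> carrier G" "s \<preceq> D 1" using Cons.hyps P_carrier by (auto simp: le_def D_1)
    have "s \<otimes> word_val G w \<preceq> s \<otimes> D (int n)" using n s by (intro le_mult_left)
    also have "\<dots> \<preceq> D 1 \<otimes> D (int n)" using s by (intro le_mult_D)
    also have "\<dots> = D (int (Suc n))" using D_add[of 1 "int n"] by simp
    finally have "s \<otimes> word_val G w \<preceq> D (int (Suc n))" .
    then show ?case unfolding word_val_Cons by blast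
  qed
  then show ?thesis using generated[OF assms] by blast
qed

lemma bounded_by_D:
  assumes "g \<in> carrier G"
  shows "\<exists>n::nat. D (- int n) \<preceq> g \<and> g \<preceq> D (int n)"
proof -
  obtain x y where xy: "x \<in> P" "y \<in> P" "g = inv x \<otimes> y" using fractions[OF assms] by blast
  then have c: "x \<in> carrier G" "y \<in> carrier G" using P_carrier by auto
  obtain m n where m: "x \<preceq> D (int m)" and n: "y \<preceq> D (int n)" using xy P_le_D by blast
  have "\<one> \<otimes> D (- int m) \<preceq> inv x"
  proof -
    have "inv x \<otimes> x \<preceq> inv x \<otimes> D (int m)" using m c by (intro le_mult_left) auto
    then show ?thesis using c by (subst mult_D_le_iff) auto
  qed
  also have "\<dots> \<preceq> g" unfolding xy(3) using xy c by (intro le_mult_P) (auto simp: one_le_iff)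
  finally have 1: "D (- int m) \<preceq> g" by simp
  have "g \<preceq> inv x \<otimes> D (int n)" unfolding xy(3) using c n by (intro le_mult_left) auto
  also have "\<dots> \<preceq> D (int n)"
  proof -
    have "\<one> \<preceq> x" using xy by (simp add: one_le_iff)
    from le_mult_left[OF _ this, of "inv x"] have "inv x \<preceq> \<one>" using c by simp
    from le_mult_D[OF this, of "int n"] show ?thesis by simp
  qed
  finally have 2: "g \<preceq> D (int n)" .
  show ?thesis
    using le_trans[OF D_mono 1, of "- int (max m n)"] le_trans[OF 2 D_mono, of "int (max m n)"]
    by (intro exI[of _ "max m n"]) auto
qed

section \<open>Meets and joins\<close>

text \<open>Meets and joins in the preorder on the whole group; they are relations,
  since in a preorder they need not be unique.\<close>
definition is_meet :: "'a \<Rightarrow> 'a \<Rightarrow> 'a \<Rightarrow> bool" where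
  "is_meet x y m \<longleftrightarrow> m \<preceq> x \<and> m \<preceq> y \<and> (\<forall>e. e \<preceq> x \<longrightarrow> e \<preceq> y \<longrightarrow> e \<preceq> m)"

definition is_join :: "'a \<Rightarrow> 'a \<Rightarrow> 'a \<Rightarrow> bool" where
  "is_join x y j \<longleftrightarrow> x \<preceq> j \<and> y \<preceq> j \<and> (\<forall>e. x \<preceq> e \<longrightarrow> y \<preceq> e \<longrightarrow> j \<preceq> e)"

lemma is_meet_mult_left:
  assumes "is_meet x y m" "z \<in> carrier G"
  shows "is_meet (z \<otimes> x) (z \<otimes> y) (z \<otimes> m)"
  unfolding is_meet_def
proof (intro conjI allI impI)
  have c: "x \<in> carrier G" "y \<in> carrier G" "m \<in> carrier G" using assms leD by (auto simp: is_meet_def)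
  show "z \<otimes> m \<preceq> z \<otimes> x" "z \<otimes> m \<preceq> z \<otimes> y" using assms le_mult_left by (auto simp: is_meet_def)
  show "e \<preceq> z \<otimes> m" if e: "e \<preceq> z \<otimes> x" "e \<preceq> z \<otimes> y" for e
  proof -
    have "inv z \<otimes> e \<preceq> x" "inv z \<otimes> e \<preceq> y" using e c assms(2) by (simp_all add: inv_mult_le_iff leD)
    then have "inv z \<otimes> e \<preceq> m" using assms by (simp add: is_meet_def)
    then show ?thesis using e(1) c assms(2) by (simp add: inv_mult_le_iff leD)
  qed
qed

lemma is_join_mult_left:
  assumes "is_join x y j" "z \<in> carrier G"
  shows "is_join (z \<otimes> x) (z \<otimes> y) (z \<otimes> j)"
  unfolding is_join_def
proof (intro conjI allI impI)
  have c: "x \<in> carrier G" "y \<in> carrier G" "j \<in> carrier G" using assms leD by (auto simp: is_join_def)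
  show "z \<otimes> x \<preceq> z \<otimes> j" "z \<otimes> y \<preceq> z \<otimes> j" using assms le_mult_left by (auto simp: is_join_def)
  show "z \<otimes> j \<preceq> e" if e: "z \<otimes> x \<preceq> e" "z \<otimes> y \<preceq> e" for e
  proof -
    have ec: "e \<in> carrier G" using e leD by blast
    have "x \<preceq> inv z \<otimes> e" "y \<preceq> inv z \<otimes> e"
      using le_mult_left[OF _ e(1), of "inv z"] le_mult_left[OF _ e(2), of "inv z"] c assms(2)
      by (simp_all add: inv_mult_cancel)
    then have "j \<preceq> inv z \<otimes> e" using assms by (simp add: is_join_def)
    from le_mult_left[OF assms(2) this] show ?thesis using ec assms(2) by (simp add: mult_inv_cancel)
  qed
qed

text \<open>A left gcd of positive elements is greatest only among the positive common lower bounds. An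
  arbitrary lower bound becomes positive after left multiplication by a high power of \<open>\<Delta>\<close>, and
  gcd's are compatible with left multiplication.\<close>
lemma positive_meet:
  assumes "x \<in> P" "y \<in> P"
  shows "\<exists>d. is_meet x y d"
proof -
  obtain d where d: "d \<in> P" "d \<preceq> x" "d \<preceq> y"
    and greatest: "\<And>e. e \<in> P \<Longrightarrow> e \<preceq> x \<Longrightarrow> e \<preceq> y \<Longrightarrow> e \<preceq> d"
    using gcd_P[OF assms] assms P_carrier unfolding le_def by blast
  have "e \<preceq> d" if e: "e \<preceq> x" "e \<preceq> y" for e
  proof -
    have c: "x \<in> carrier G" "y \<in> carrier G" "e \<in> carrier G" "d \<in> carrier G"
      using e d leD by auto
    \<comment> \<open>Translation by \<open>z\<close> makes \<open>e\<close> positive.\<close>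
    obtain n where "D (- int n) \<preceq> e" using bounded_by_D c by blast
    define z where "z = D (int n)"
    have z: "z \<in> carrier G" "\<one> \<preceq> z" using D_nonneg by (auto simp: z_def)
    have ze: "z \<otimes> e \<in> P"
    proof -
      have "z \<otimes> D (- int n) \<preceq> z \<otimes> e" using \<open>D (- int n) \<preceq> e\<close> z by (intro le_mult_left)
      moreover have "z \<otimes> D (- int n) = \<one>" by (simp add: z_def flip: D_add)
      ultimately show ?thesis by (simp add: one_le_iff)
    qed
    have zx: "z \<otimes> x \<in> P" "z \<otimes> y \<in> P" using z assms mult_P by (auto simp: one_le_iff)
    obtain d2 where d2: "d2 \<in> P" "d2 \<preceq> z \<otimes> x" "d2 \<preceq> z \<otimes> y"
      and greatest2: "\<And>e. e \<in> P \<Longrightarrow> e \<preceq> z \<otimes> x \<Longrightarrow> e \<preceq> z \<otimes> y \<Longrightarrow> e \<preceq> d2"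
      using gcd_P[OF zx] zx P_carrier unfolding le_def by blast
    have d2c: "d2 \<in> carrier G" using d2 leD by blast
    \<comment> \<open>The gcd \<open>d2\<close> of the translates is a multiple of \<open>z\<close>, hence it divides \<open>z d\<close>.\<close>
    have "z \<otimes> e \<preceq> d2" using ze e z by (intro greatest2 le_mult_left)
    moreover have "z \<preceq> d2"
      using z assms by (intro greatest2 le_mult_P) (auto simp: one_le_iff)
    then have "inv z \<otimes> d2 \<in> P" by (simp add: le_def)
    then have "inv z \<otimes> d2 \<preceq> d"
      using d2 z c d2c by (intro greatest) (auto simp: inv_mult_le_iff)
    then have "d2 \<preceq> z \<otimes> d" using z c d2c by (simp add: inv_mult_le_iff)
    ultimately have "z \<otimes> e \<preceq> z \<otimes> d" by (rule le_trans)
    then show ?thesis using mult_le_iff z c by blast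
  qed
  then show ?thesis using d unfolding is_meet_def by blast
qed

text \<open>Meets, and likewise joins, are 1-Lipschitz for the distance in which \<open>x\<close> and \<open>x'\<close> are \<open>N\<close>-close
  if \<open>x \<Delta>\<^sup>-\<^sup>N \<preceq> x' \<preceq> x \<Delta>\<^sup>N\<close>: right multiplication by \<open>\<Delta>\<^sup>N\<close> preserves the order.\<close>
lemma meet_close:
  assumes m: "is_meet x y m" "is_meet x' y' m'"
    and x: "x \<otimes> D (- N) \<preceq> x'" "x' \<preceq> x \<otimes> D N"
    and y: "y \<otimes> D (- N) \<preceq> y'" "y' \<preceq> y \<otimes> D N"
  shows "m \<otimes> D (- N) \<preceq> m'" "m' \<preceq> m \<otimes> D N"
proof -
  have c: "x \<in> carrier G" "y \<in> carrier G" "x' \<in> carrier G" "y' \<in> carrier G"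
    "m \<in> carrier G" "m' \<in> carrier G"
    using m leD unfolding is_meet_def by blast+
  have "m \<otimes> D (- N) \<preceq> x \<otimes> D (- N)" "m \<otimes> D (- N) \<preceq> y \<otimes> D (- N)"
    using m by (auto intro: le_mult_D simp: is_meet_def)
  then show "m \<otimes> D (- N) \<preceq> m'"
    using m(2) le_trans x(1) y(1) unfolding is_meet_def by blast
  have "x' \<otimes> D (- N) \<preceq> x" "y' \<otimes> D (- N) \<preceq> y"
    using x y c by (simp_all add: mult_D_le_iff)
  moreover have "m' \<otimes> D (- N) \<preceq> x' \<otimes> D (- N)" "m' \<otimes> D (- N) \<preceq> y' \<otimes> D (- N)"
    using m by (auto intro: le_mult_D simp: is_meet_def)
  ultimately have "m' \<otimes> D (- N) \<preceq> m"
    using m(1) le_trans unfolding is_meet_def by blast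
  then show "m' \<preceq> m \<otimes> D N" using c by (simp add: mult_D_le_iff)
qed

lemma join_close:
  assumes j: "is_join x y j" "is_join x' y' j'"
    and x: "x \<otimes> D (- N) \<preceq> x'" "x' \<preceq> x \<otimes> D N"
    and y: "y \<otimes> D (- N) \<preceq> y'" "y' \<preceq> y \<otimes> D N"
  shows "j \<otimes> D (- N) \<preceq> j'" "j' \<preceq> j \<otimes> D N"
proof -
  have c: "x \<in> carrier G" "y \<in> carrier G" "x' \<in> carrier G" "y' \<in> carrier G"
    "j \<in> carrier G" "j' \<in> carrier G"
    using j leD unfolding is_join_def by blast+
  have "x \<otimes> D N \<preceq> j \<otimes> D N" "y \<otimes> D N \<preceq> j \<otimes> D N"
    using j by (auto intro: le_mult_D simp: is_join_def)
  then show "j' \<preceq> j \<otimes> D N"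
    using j(2) le_trans x(2) y(2) unfolding is_join_def by blast
  have "x \<preceq> x' \<otimes> D N" "y \<preceq> y' \<otimes> D N"
    using x y c mult_D_le_iff[of x x' "- N"] mult_D_le_iff[of y y' "- N"] by simp_all
  moreover have "x' \<otimes> D N \<preceq> j' \<otimes> D N" "y' \<otimes> D N \<preceq> j' \<otimes> D N"
    using j by (auto intro: le_mult_D simp: is_join_def)
  ultimately have "j \<preceq> j' \<otimes> D N"
    using j(1) le_trans unfolding is_join_def by blast
  then show "j \<otimes> D (- N) \<preceq> j'" using c mult_D_le_iff[of j j' "- N"] by simp
qed

section \<open>Simple elements and finiteness of intervals\<close>

text \<open>The simple elements, i.e. the divisors of \<open>\<Delta>\<close>.\<close>
definition simples :: "'a set" where
  "simples = {s. \<one> \<preceq> s \<and> s \<preceq> \<Delta>}"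

lemma finite_simples: "finite simples"
proof -
  have "simples \<subseteq> {s \<in> P. inv s \<otimes> \<Delta> \<in> P}"
    by (auto simp: simples_def one_le_iff le_def)
  then show ?thesis using finite_divisors finite_subset by blast
qed

lemma simples_carrier: "simples \<subseteq> carrier G"
  using leD by (auto simp: simples_def)

lemma Delta_simple: "\<Delta> \<in> simples"
  using Delta_P by (auto simp: simples_def one_le_iff le_refl)

text \<open>If \<open>s\<close> is a meet of \<open>x\<close> and \<open>\<Delta>\<close>, then every lower bound of \<open>x\<close> and \<open>\<Delta>\<^sup>n\<^sup>+\<^sup>1\<close> lies below
  \<open>s \<Delta>\<^sup>n\<close>. This is what makes splitting off the head \<open>s\<close> reduce the exponent by one.\<close>
lemma head_bound:
  assumes s: "is_meet x \<Delta> s" and e: "e \<preceq> x" "e \<preceq> D (1 + n)" and "0 \<le> n"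
  shows "e \<preceq> s \<otimes> D n"
proof -
  have c: "e \<in> carrier G" "s \<in> carrier G" using s e leD unfolding is_meet_def by blast+
  have "e \<otimes> D (- n) \<preceq> e" using c le_mult_D_nonneg \<open>0 \<le> n\<close> by (simp add: mult_D_le_iff)
  then have "e \<otimes> D (- n) \<preceq> x" using e(1) by (rule le_trans)
  moreover have "e \<otimes> D (- n) \<preceq> \<Delta>"
    using le_mult_D[OF e(2), of "- n"] by (simp add: D_1 flip: D_add)
  ultimately have "e \<otimes> D (- n) \<preceq> s" using s by (simp add: is_meet_def)
  then show ?thesis using c by (simp add: mult_D_le_iff)
qed

lemma positive_decomp:
  assumes x: "\<one> \<preceq> x" "x \<preceq> D (1 + n)" and "0 \<le> n"
  shows "\<exists>s \<in> simples. \<exists>y. is_meet x \<Delta> s \<and> x = s \<otimes> y \<and> \<one> \<preceq> y \<and> y \<preceq> D n"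
proof -
  obtain s where s: "is_meet x \<Delta> s" using positive_meet x Delta_P by (auto simp: one_le_iff)
  have c: "x \<in> carrier G" "s \<in> carrier G" using s leD unfolding is_meet_def by blast+
  have "\<one> \<preceq> s" using s x Delta_P by (simp add: is_meet_def flip: one_le_iff)
  then have "s \<in> simples" using s by (simp add: simples_def is_meet_def)
  moreover have "x = s \<otimes> (inv s \<otimes> x)" using c by (simp add: mult_inv_cancel)
  moreover have "\<one> \<preceq> inv s \<otimes> x" using s by (simp add: is_meet_def le_def one_le_iff)
  moreover have "inv s \<otimes> x \<preceq> D n"
    using head_bound[OF s _ x(2) \<open>0 \<le> n\<close>] c le_refl by (simp add: inv_mult_le_iff)
  ultimately show ?thesis using s by blast
qed

lemma finite_positive_interval: "finite {x. \<one> \<preceq> x \<and> x \<preceq> D (int n)}"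
proof (induction n)
  case 0
  have "{x. \<one> \<preceq> x \<and> x \<preceq> D (int 0)} \<subseteq> simples"
    using Delta_P le_trans by (auto simp: simples_def one_le_iff[of \<Delta>, symmetric])
  then show ?case using finite_simples finite_subset by blast
next
  case (Suc n)
  have "{x. \<one> \<preceq> x \<and> x \<preceq> D (int (Suc n))} \<subseteq>
      (\<lambda>(s, y). s \<otimes> y) ` (simples \<times> {x. \<one> \<preceq> x \<and> x \<preceq> D (int n)})"
  proof
    fix x assume "x \<in> {x. \<one> \<preceq> x \<and> x \<preceq> D (int (Suc n))}"
    then obtain s y where "s \<in> simples" "x = s \<otimes> y" "\<one> \<preceq> y" "y \<preceq> D (int n)"
      using positive_decomp[of x "int n"] by auto
    then show "x \<in> (\<lambda>(s, y). s \<otimes> y) ` (simples \<times> {x. \<one> \<preceq> x \<and> x \<preceq> D (int n)})" by force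
  qed
  then show ?case
    by (rule finite_subset) (intro finite_imageI finite_cartesian_product finite_simples Suc)
qed

text \<open>The order interval between \<open>\<Delta>\<^sup>-\<^sup>N\<close> and \<open>\<Delta>\<^sup>N\<close>; it serves as ball of radius \<open>N\<close> around the
  identity.\<close>
definition ball :: "nat \<Rightarrow> 'a set" where
  "ball N = {h. D (- int N) \<preceq> h \<and> h \<preceq> D (int N)}"

lemma finite_ball: "finite (ball N)"
proof -
  have "ball N \<subseteq> (\<otimes>) (D (- int N)) ` {x. \<one> \<preceq> x \<and> x \<preceq> D (int (2 * N))}"
  proof
    fix h assume h: "h \<in> ball N"
    then have c: "h \<in> carrier G" using leD by (auto simp: ball_def)
    have "D (int N) \<otimes> D (- int N) \<preceq> D (int N) \<otimes> h" "D (int N) \<otimes> h \<preceq> D (int N) \<otimes> D (int N)"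
      using h by (auto simp: ball_def intro: le_mult_left)
    moreover have "D (int N) \<otimes> D (- int N) = \<one>" "D (int N) \<otimes> D (int N) = D (int (2 * N))"
      by (simp_all flip: D_add)
    ultimately have "\<one> \<preceq> D (int N) \<otimes> h" "D (int N) \<otimes> h \<preceq> D (int (2 * N))"
      by simp_all
    moreover have "h = D (- int N) \<otimes> (D (int N) \<otimes> h)"
      using c by (simp add: group_word_simps flip: inv_D)
    ultimately show "h \<in> (\<otimes>) (D (- int N)) ` {x. \<one> \<preceq> x \<and> x \<preceq> D (int (2 * N))}" by blast
  qed
  then show ?thesis using finite_positive_interval finite_subset by blast
qed

lemma ball_inv:
  assumes "h \<in> ball N"
  shows "inv h \<in> ball N"
proof -
  have c: "h \<in> carrier G" and h: "\<one> \<otimes> D (- int N) \<preceq> h" "h \<preceq> D (int N)"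
    using assms leD by (auto simp: ball_def)
  have "\<one> \<preceq> h \<otimes> D (int N)" using h(1) c mult_D_le_iff[of \<one> h "- int N"] by simp
  from le_mult_left[OF _ this, of "inv h"] have 1: "inv h \<preceq> D (int N)"
    using c by (simp add: inv_mult_cancel)
  have "\<one> \<preceq> inv h \<otimes> D (int N)" using le_mult_left[OF _ h(2), of "inv h"] c by simp
  then have "\<one> \<otimes> D (- int N) \<preceq> inv h" using c mult_D_le_iff[of \<one> "inv h" "- int N"] by simp
  then show ?thesis using 1 by (simp add: ball_def)
qed

lemma simples_ball: "simples \<subseteq> ball 1"
proof
  fix s assume "s \<in> simples"
  moreover have "D (- 1) \<preceq> \<one>" using D_mono[of "- 1" 0] by simp
  ultimately show "s \<in> ball 1" using le_trans by (auto simp: ball_def simples_def D_1)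
qed

section \<open>Normal forms\<close>

text \<open>The local condition on consecutive letters of a left greedy normal form.\<close>
definition greedy :: "'a \<Rightarrow> 'a \<Rightarrow> bool" where
  "greedy s s' \<longleftrightarrow> is_meet (s \<otimes> s') \<Delta> s"

text \<open>Allowed consecutive letters of the words \<open>\<Delta>\<^sup>-\<^sup>k s\<^sub>1 \<dots> s\<^sub>n\<close> with greedy simple part. That
  \<open>\<Delta>\<close> does not divide \<open>s\<^sub>1\<close> if \<open>k > 0\<close> makes \<open>k\<close> minimal, unless \<open>\<Delta>\<inverse>\<close> is
  positive. Trailing letters \<open>1\<close> are allowed, so an element has several normal forms.\<close>
definition normal_step :: "'a \<Rightarrow> 'a \<Rightarrow> bool" where
  "normal_step x y \<longleftrightarrow> x = inv \<Delta> \<and> (y = inv \<Delta> \<or> y \<in> simples \<and> \<not> \<Delta> \<preceq> y)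
     \<or> x \<in> simples \<and> y \<in> simples \<and> greedy x y"

text \<open>The language of the biautomatic structure. It is defined by a condition on consecutive letters
  and thus regular; the shape \<open>\<Delta>\<^sup>-\<^sup>k s\<^sub>1 \<dots> s\<^sub>n\<close> of its words is a consequence.\<close>
definition normal_forms :: "'a list set" where
  "normal_forms = {w \<in> lists (insert (inv \<Delta>) simples). successively normal_step w}"

lemma word_val_simples:
  assumes "s \<in> lists simples"
  shows "word_val G s \<in> carrier G" "\<one> \<preceq> word_val G s"
proof -
  show "\<one> \<preceq> word_val G s"
    using assms
  proof (induction s)
    case (Cons a s)
    then show ?case using mult_P by (auto simp: simples_def one_le_iff)
  qed (simp add: le_refl)
  then show "word_val G s \<in> carrier G" by (rule leD)
qed

lemma word_val_replicate: "word_val G (replicate k (inv \<Delta>)) = D (- int k)"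
proof (induction k)
  case (Suc k)
  then show ?case using D_add[of "- 1" "- int k"] by (simp add: D_neg_1)
qed simp

lemma word_val_shift:
  assumes "s \<in> lists simples"
  shows "word_val G (replicate k (inv \<Delta>) @ s) = D (- int k) \<otimes> word_val G s"
proof -
  have "s \<in> lists (carrier G)" using assms lists_mono[OF simples_carrier] by blast
  moreover have "replicate k (inv \<Delta>) \<in> lists (carrier G)" by (induction k) auto
  ultimately show ?thesis
    using word_val_append[of "replicate k (inv \<Delta>)" s] by (simp only: word_val_replicate)
qed

lemma is_meet_lower: "x \<preceq> y \<Longrightarrow> is_meet x y x"
  using le_refl leD by (auto simp: is_meet_def)

lemma is_meet_lower': "y \<preceq> x \<Longrightarrow> is_meet x y y"
  using le_refl leD by (auto simp: is_meet_def)

lemma is_join_upper: "y \<preceq> x \<Longrightarrow> is_join x y x"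
  using le_refl leD by (auto simp: is_join_def)

lemma is_join_upper': "x \<preceq> y \<Longrightarrow> is_join x y y"
  using le_refl leD by (auto simp: is_join_def)

text \<open>The local greedy condition determines all prefixes: the value of the prefix of length \<open>j\<close> is
  the gcd of the whole element and \<open>\<Delta>\<^sup>j\<close>.\<close>
lemma greedy_prefix:
  assumes "s \<in> lists simples" "successively greedy s"
  shows "is_meet (word_val G s) (D (int j)) (word_val G (take j s))"
  using assms
proof (induction s arbitrary: j rule: list.induct)
  case Nil
  then show ?case using D_nonneg by (auto intro: is_meet_lower)
next
  case (Cons a s)
  have a: "a \<in> carrier G" "\<one> \<preceq> a" "a \<preceq> \<Delta>" using Cons.prems leD by (auto simp: simples_def)
  have s: "s \<in> lists simples" "successively greedy s"
    using Cons.prems by (auto simp: successively_Cons)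
  note sc = word_val_simples[OF s(1)]
  note IH = Cons.IH[OF s]
  \<comment> \<open>By induction the second letter is the head of the tail, so that the local condition on the
    first two letters makes \<open>a\<close> the head of the whole word.\<close>
  have head: "is_meet (a \<otimes> word_val G s) \<Delta> a"
    unfolding is_meet_def
  proof (intro conjI allI impI)
    show "a \<preceq> a \<otimes> word_val G s" "a \<preceq> \<Delta>" using a sc by (auto intro: le_mult_P)
    show "e \<preceq> a" if e: "e \<preceq> a \<otimes> word_val G s" "e \<preceq> \<Delta>" for e
    proof -
      have ec: "e \<in> carrier G" using e leD by blast
      have "\<Delta> \<preceq> a \<otimes> \<Delta>" using le_mult_D[OF a(2), of 1] by (simp add: D_1)
      then have "e \<preceq> a \<otimes> \<Delta>" using e(2) le_trans by blast
      then have "inv a \<otimes> e \<preceq> word_val G s" "inv a \<otimes> e \<preceq> D (int 1)"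
        using e ec a sc by (simp_all add: inv_mult_le_iff D_1)
      then have le1: "inv a \<otimes> e \<preceq> word_val G (take 1 s)" using IH[of 1] by (simp add: is_meet_def)
      then have *: "e \<preceq> a \<otimes> word_val G (take 1 s)"
        using inv_mult_le_iff[OF a(1) ec leD(2)[OF le1]] by simp
      show ?thesis
      proof (cases s)
        case Nil
        then show ?thesis using * a by simp
      next
        case (Cons b s')
        then have "b \<in> carrier G" "greedy a b" using Cons.prems s simples_carrier by auto
        then show ?thesis using * e(2) Cons by (simp add: greedy_def is_meet_def)
      qed
    qed
  qed
  show ?case
  proof (cases j)
    case 0
    then show ?thesis using word_val_simples(2)[OF Cons.prems(1)] by (auto intro: is_meet_lower')
  next
    case (Suc n)
    note IHn = IH[of n]
    let ?p = "word_val G (take n s)"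
    have pc: "?p \<in> carrier G" using IHn leD unfolding is_meet_def by blast
    have "is_meet (a \<otimes> word_val G s) (D (int (Suc n))) (a \<otimes> ?p)"
      unfolding is_meet_def
    proof (intro conjI allI impI)
      show "a \<otimes> ?p \<preceq> a \<otimes> word_val G s" using IHn a by (auto intro: le_mult_left simp: is_meet_def)
      have "a \<otimes> ?p \<preceq> a \<otimes> D (int n)" using IHn a by (auto intro: le_mult_left simp: is_meet_def)
      also have "\<dots> \<preceq> \<Delta> \<otimes> D (int n)" using a by (intro le_mult_D)
      also have "\<dots> = D (int (Suc n))" using D_add[of 1 "int n"] by (simp add: D_1)
      finally show "a \<otimes> ?p \<preceq> D (int (Suc n))" .
      show "e \<preceq> a \<otimes> ?p" if e: "e \<preceq> a \<otimes> word_val G s" "e \<preceq> D (int (Suc n))" for e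
      proof -
        have ec: "e \<in> carrier G" using e leD by blast
        have "e \<preceq> a \<otimes> D (int n)" using head_bound[OF head e(1), of "int n"] e(2) by simp
        then have "inv a \<otimes> e \<preceq> word_val G s" "inv a \<otimes> e \<preceq> D (int n)"
          using e ec a sc by (simp_all add: inv_mult_le_iff)
        then have "inv a \<otimes> e \<preceq> ?p" using IHn by (simp add: is_meet_def)
        then show ?thesis using a ec pc by (simp add: inv_mult_le_iff)
      qed
    qed
    then show ?thesis using Suc by simp
  qed
qed

lemma greedy_word_exists:
  assumes "\<one> \<preceq> y" "y \<preceq> D (int (Suc n))"
  shows "\<exists>s \<in> lists simples. s \<noteq> [] \<and> successively greedy s \<and> word_val G s = y"
  using assms
proof (induction n arbitrary: y)
  case 0
  then have "y \<in> simples" by (simp add: simples_def D_1)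
  then show ?case using simples_carrier by (intro bexI[of _ "[y]"]) auto
next
  case (Suc n)
  obtain a z where a: "a \<in> simples" "is_meet y \<Delta> a" "y = a \<otimes> z"
    and z: "\<one> \<preceq> z" "z \<preceq> D (int (Suc n))"
    using positive_decomp[of y "int (Suc n)"] Suc.prems by auto
  obtain s where s: "s \<in> lists simples" "s \<noteq> []" "successively greedy s" "word_val G s = z"
    using Suc.IH[OF z] by blast
  obtain b s' where bs: "s = b # s'" using s(2) by (cases s) auto
  have b: "b \<in> carrier G" "b \<preceq> \<Delta>" "\<one> \<preceq> b" "\<one> \<preceq> word_val G s'"
    using s(1) simples_carrier word_val_simples[of s'] unfolding bs by (auto simp: simples_def)
  have ac: "a \<in> carrier G" using a(1) simples_carrier by blast
  have "b \<preceq> z" using s(4) le_mult_P b unfolding bs by auto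
  then have "a \<otimes> b \<preceq> y" unfolding a(3) using ac by (intro le_mult_left)
  then have "greedy a b"
    unfolding greedy_def is_meet_def
    using a(2) ac b le_mult_P le_trans unfolding is_meet_def by blast
  then have "successively greedy (a # s)" using s(3) bs by simp
  then show ?case using a s by (intro bexI[of _ "a # s"]) auto
qed

lemma normal_form_exists:
  assumes "g \<in> carrier G"
  shows "\<exists>w \<in> normal_forms. word_val G w = g"
proof -
  \<comment> \<open>The least exponent is taken in order that \<open>\<Delta>\<close> does not divide the first simple letter.\<close>
  define k where "k = (LEAST k::nat. D (- int k) \<preceq> g)"
  obtain n where n: "D (- int n) \<preceq> g" "g \<preceq> D (int n)" using bounded_by_D[OF assms] by blast
  have k: "D (- int k) \<preceq> g" unfolding k_def using n(1) by (rule LeastI)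
  define y where "y = D (int k) \<otimes> g"
  have "D (int k) \<otimes> D (- int k) \<preceq> y" unfolding y_def using k by (intro le_mult_left) auto
  then have y1: "\<one> \<preceq> y" by (simp flip: D_add)
  have "y \<preceq> D (int k) \<otimes> D (int n)" unfolding y_def using n by (intro le_mult_left) auto
  then have "y \<preceq> D (int k + int n)" by (simp add: D_add)
  then have "y \<preceq> D (int (Suc (k + n)))" by (rule le_trans) (auto intro: D_mono)
  from greedy_word_exists[OF y1 this]
  obtain s where s: "s \<in> lists simples" "s \<noteq> []" "successively greedy s" "word_val G s = y"
    by blast
  obtain b s' where bs: "s = b # s'" using s(2) by (cases s) auto
  have b: "b \<in> simples" "b \<in> carrier G" using s(1) simples_carrier unfolding bs by auto
  have "\<not> \<Delta> \<preceq> b" if "0 < k"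
  proof
    assume "\<Delta> \<preceq> b"
    also have "b \<preceq> y"
      using word_val_simples[of s'] s b le_mult_P unfolding bs by auto
    finally have "D (- int k) \<otimes> \<Delta> \<preceq> D (- int k) \<otimes> y" by (intro le_mult_left) auto
    moreover have "D (- int k) \<otimes> y = g"
      unfolding y_def using assms by (simp add: group_word_simps flip: inv_D)
    moreover have "D (- int k) \<otimes> \<Delta> = D (- int (k - 1))"
      using D_add[of "- int k" 1] that by (simp add: D_1 of_nat_diff)
    ultimately have "D (- int (k - 1)) \<preceq> g" by simp
    then have "k \<le> k - 1" unfolding k_def by (rule Least_le)
    then show False using that by simp
  qed
  then have "successively normal_step (replicate k (inv \<Delta>) @ s)"
    using s bs b
  proof (induction k)
    case 0
    have "successively normal_step s" if "s \<in> lists simples" "successively greedy s" for s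
      using that by (induction s rule: induct_list012) (auto simp: normal_step_def)
    then show ?case using 0 by simp
  next
    case (Suc k)
    then have 1: "\<not> \<Delta> \<preceq> b" by simp
    then have 2: "successively normal_step (replicate k (inv \<Delta>) @ s)" using Suc by simp
    then show ?case using 1 Suc.prems by (cases k) (auto simp: normal_step_def)
  qed
  then have "replicate k (inv \<Delta>) @ s \<in> normal_forms"
    using s(1) by (auto simp: normal_forms_def)
  moreover have "word_val G (replicate k (inv \<Delta>) @ s) = g"
  proof -
    have "word_val G (replicate k (inv \<Delta>) @ s) = D (- int k) \<otimes> y"
      using word_val_shift[OF s(1)] s(4) by simp
    also have "\<dots> = g" unfolding y_def using assms by (simp add: group_word_simps flip: inv_D)
    finally show ?thesis .
  qed
  ultimately show ?thesis by blast
qed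

text \<open>The letter \<open>\<Delta>\<inverse>\<close> is told apart from the simple letters only if it is not positive; the
  remaining case is degenerate, see \<open>ball_eq_carrier\<close>.\<close>
lemma normal_form_decomp:
  assumes "w \<in> normal_forms" and nontrivial: "\<not> \<one> \<preceq> inv \<Delta>"
  shows "\<exists>k s. w = replicate k (inv \<Delta>) @ s \<and> s \<in> lists simples \<and> successively greedy s \<and>
    (k = 0 \<or> s = [] \<or> \<not> \<Delta> \<preceq> hd s)"
proof -
  have ni: "inv \<Delta> \<notin> simples" using nontrivial by (simp add: simples_def)
  have "w \<in> lists (insert (inv \<Delta>) simples)" "successively normal_step w"
    using assms by (auto simp: normal_forms_def)
  then show ?thesis
  proof (induction w rule: list.induct)
    case Nil
    then show ?case by (intro exI[of _ 0] exI[of _ "[]"]) simp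
  next
    case (Cons x w)
    have w: "w \<in> lists (insert (inv \<Delta>) simples)" "successively normal_step w"
      using Cons.prems by (auto simp: successively_Cons)
    obtain k s where ks: "w = replicate k (inv \<Delta>) @ s" "s \<in> lists simples" "successively greedy s"
      "k = 0 \<or> s = [] \<or> \<not> \<Delta> \<preceq> hd s"
      using Cons.IH[OF w] by blast
    show ?case
    proof (cases "x = inv \<Delta>")
      case True
      have "\<not> \<Delta> \<preceq> hd s" if s: "s \<noteq> []"
      proof (cases "k = 0")
        case True
        obtain b s' where "s = b # s'" using s by (cases s) auto
        then show ?thesis
          using True Cons.prems ks ni \<open>x = inv \<Delta>\<close> by (auto simp: normal_step_def)
      next
        case False
        then show ?thesis using ks(4) s by blast
      qed
      then show ?thesis using True ks by (intro exI[of _ "Suc k"] exI[of _ s]) auto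
    next
      case False
      then have x: "x \<in> simples" using Cons.prems by auto
      have k: "k = 0"
      proof (rule ccontr)
        assume "k \<noteq> 0"
        then have "normal_step x (inv \<Delta>)"
          using Cons.prems(2) ks(1) by (cases k) auto
        then show False using False ni by (simp add: normal_step_def)
      qed
      have "successively greedy (x # s)"
      proof (cases s)
        case (Cons b s')
        then have "normal_step x b" using Cons.prems(2) ks(1) k by auto
        then have "greedy x b" using False by (simp add: normal_step_def)
        then show ?thesis using Cons ks(3) by simp
      qed simp
      then show ?thesis using k ks(1,2) x by (intro exI[of _ 0] exI[of _ "x # s"]) auto
    qed
  qed
qed

text \<open>The prefix of length \<open>t\<close> of a normal form \<open>\<Delta>\<^sup>-\<^sup>k s\<^sub>1 \<dots> s\<^sub>n\<close> of \<open>g\<close> is, for every \<open>t\<close>, a join of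
  \<open>\<Delta>\<^sup>-\<^sup>t\<close> and a meet of \<open>g\<close> and \<open>\<Delta>\<^sup>t\<^sup>-\<^sup>2\<^sup>k\<close>. For \<open>t \<le> k\<close> the join is \<open>\<Delta>\<^sup>-\<^sup>t\<close>,
  for \<open>t > k\<close> it is the meet, so that one expression covers both phases.\<close>
lemma normal_form_prefix:
  assumes w: "w \<in> normal_forms" and nontrivial: "\<not> \<one> \<preceq> inv \<Delta>"
  shows "\<exists>k::nat. D (- int k) \<preceq> word_val G w \<and> (k = 0 \<or> \<not> D (1 - int k) \<preceq> word_val G w) \<and>
    (\<forall>t. \<exists>q. is_meet (word_val G w) (D (int t - 2 * int k)) q \<and>
      is_join q (D (- int t)) (word_val G (take t w)))"
proof -
  obtain k s where ks: "w = replicate k (inv \<Delta>) @ s" "s \<in> lists simples" "successively greedy s"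
    "k = 0 \<or> s = [] \<or> \<not> \<Delta> \<preceq> hd s"
    using normal_form_decomp[OF assms] by blast
  let ?g = "word_val G w" and ?y = "word_val G s"
  note y = word_val_simples[OF ks(2)]
  have g: "?g = D (- int k) \<otimes> ?y" unfolding ks(1) using word_val_shift[OF ks(2)] .
  have 1: "D (- int k) \<preceq> ?g" unfolding g using y by (intro le_mult_P) auto
  have 2: "\<not> D (1 - int k) \<preceq> ?g" if "k \<noteq> 0"
  proof
    assume "D (1 - int k) \<preceq> ?g"
    then have "D (- int k) \<otimes> \<Delta> \<preceq> D (- int k) \<otimes> ?y"
      using D_add[of "- int k" 1] g by (simp add: D_1)
    then have *: "\<Delta> \<preceq> ?y" using mult_le_iff y by simp
    show False
    proof (cases s)
      case Nil
      then have "\<Delta> \<preceq> \<one>" using * by simp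
      from le_mult_left[OF _ this, of "inv \<Delta>"] show False using nontrivial by simp
    next
      case (Cons a s')
      then have "a \<in> carrier G" using ks(2) simples_carrier by auto
      then have "is_meet ?y \<Delta> a" using greedy_prefix[OF ks(2,3), of 1] Cons by (simp add: D_1)
      then have "\<Delta> \<preceq> a" using * le_refl by (simp add: is_meet_def)
      then show False using ks(4) that Cons by simp
    qed
  qed
  have 3: "\<exists>q. is_meet ?g (D (int t - 2 * int k)) q \<and> is_join q (D (- int t)) (word_val G (take t w))"
    for t
  proof (cases "t \<le> k")
    case True
    have "D (int t - 2 * int k) \<preceq> ?g" using True by (intro le_trans[OF D_mono 1]) simp
    then have "is_meet ?g (D (int t - 2 * int k)) (D (int t - 2 * int k))" by (rule is_meet_lower')
    moreover have "word_val G (take t w) = D (- int t)"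
      using True ks(1) word_val_replicate[of t] by (simp add: min_absorb1)
    moreover have "is_join (D (int t - 2 * int k)) (D (- int t)) (D (- int t))"
      using True by (intro is_join_upper' D_mono) simp
    ultimately show ?thesis by auto
  next
    case False
    let ?j = "t - k"
    have j: "D (- int k) \<otimes> D (int ?j) = D (int t - 2 * int k)"
      using False by (simp add: of_nat_diff flip: D_add)
    have tk: "take ?j s \<in> lists simples" using ks(2) by (auto dest: in_set_takeD)
    have val_t: "word_val G (take t w) = D (- int k) \<otimes> word_val G (take ?j s)"
      using word_val_shift[OF tk] False ks(1) by simp
    have "is_meet ?g (D (int t - 2 * int k)) (word_val G (take t w))"
      using is_meet_mult_left[OF greedy_prefix[OF ks(2,3), of ?j], of "D (- int k)"]
      unfolding g val_t j by simp
    moreover have "D (- int t) \<preceq> word_val G (take t w)"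
    proof -
      have "D (- int t) \<preceq> D (- int k)" using False by (intro D_mono) simp
      also have "\<dots> \<preceq> word_val G (take t w)"
        unfolding val_t using word_val_simples[OF tk] by (intro le_mult_P) auto
      finally show ?thesis .
    qed
    ultimately show ?thesis using is_join_upper by blast
  qed
  show ?thesis using 1 2 3 by (intro exI[of _ k]) blast
qed

section \<open>The fellow traveller property\<close>

lemma ballD:
  assumes "h \<in> ball N"
  shows "h \<in> carrier G" "D (- int N) \<preceq> h" "h \<preceq> D (int N)"
  using assms leD by (auto simp: ball_def)

lemma mult_ball_close:
  assumes "x \<in> carrier G" "c \<in> ball N"
  shows "x \<otimes> D (- int N) \<preceq> x \<otimes> c" "x \<otimes> c \<preceq> x \<otimes> D (int N)"
  using assms ballD by (auto intro: le_mult_left)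

lemma ball_mult_D_close:
  assumes "b \<in> ball N"
  shows "D (m - int N) \<preceq> b \<otimes> D m" "b \<otimes> D m \<preceq> D (m + int N)"
  using le_mult_D[OF ballD(2)[OF assms], of m] le_mult_D[OF ballD(3)[OF assms], of m]
  by (simp_all add: algebra_simps flip: D_add)

lemma ball_mult_lower:
  assumes b: "b \<in> ball 1" and c: "c \<in> ball 1" and x: "D m \<preceq> x"
  shows "D (m - 2) \<preceq> b \<otimes> x \<otimes> c"
proof -
  have cl: "x \<in> carrier G" "b \<in> carrier G" "c \<in> carrier G" using x b c leD ballD by auto
  have "D (m - 1) \<preceq> b \<otimes> D m" using ball_mult_D_close(1)[OF b, of m] by simp
  also have "\<dots> \<preceq> b \<otimes> x" using cl x by (intro le_mult_left)
  finally have "D (m - 1) \<otimes> D (- 1) \<preceq> b \<otimes> x \<otimes> D (- 1)" by (rule le_mult_D)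
  also have "\<dots> \<preceq> b \<otimes> x \<otimes> c" using mult_ball_close(1)[OF _ c, of "b \<otimes> x"] cl by simp
  finally show ?thesis by (simp flip: D_add)
qed

lemma normal_form_exponent_close:
  assumes b: "b \<in> ball 1" and c: "c \<in> ball 1"
    and k: "D (- int k) \<preceq> x" and k': "k' = 0 \<or> \<not> D (1 - int k') \<preceq> b \<otimes> x \<otimes> c"
  shows "k' \<le> k + 2"
proof (rule ccontr)
  assume *: "\<not> k' \<le> k + 2"
  have "D (1 - int k') \<preceq> D (- int k - 2)" using * by (intro D_mono) simp
  also have "\<dots> \<preceq> b \<otimes> x \<otimes> c" by (rule ball_mult_lower[OF b c k])
  finally show False using k' * by simp
qed

lemma close_mono:
  assumes "x \<otimes> D (- m) \<preceq> y" "y \<preceq> x \<otimes> D m" "m \<le> n" "x \<in> carrier G"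
  shows "x \<otimes> D (- n) \<preceq> y" "y \<preceq> x \<otimes> D n"
  using assms le_trans[OF le_mult_left[OF _ D_mono[of "- n" "- m"]] assms(1)]
    le_trans[OF assms(2) le_mult_left[OF _ D_mono[of m n]]] by auto

text \<open>In the degenerate case that \<open>\<Delta>\<inverse>\<close> is positive, all elements are equivalent in the preorder and
  the group is finite.\<close>
lemma ball_eq_carrier:
  assumes "\<one> \<preceq> inv \<Delta>"
  shows "ball N = carrier G"
proof -
  have D: "D m \<preceq> D n" for m n
  proof (cases "m \<le> n")
    case False
    have "\<one> \<preceq> D (- int k)" for k
    proof (induction k)
      case (Suc k)
      then show ?case using mult_P[of "inv \<Delta>" "D (- int k)"] assms D_add[of "- 1" "- int k"]
        by (simp add: one_le_iff D_neg_1)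
    qed (simp add: le_refl)
    from le_mult_P[OF _ this, of "D m" "nat (m - n)"] show ?thesis
      using False by (simp flip: D_add)
  qed (rule D_mono)
  have "h \<in> ball N" if "h \<in> carrier G" for h
    using bounded_by_D[OF that] D le_trans unfolding ball_def by blast
  then show ?thesis using ballD by blast
qed

text \<open>Normal forms of \<open>g\<close> and \<open>b g c\<close>, with \<open>b\<close> and \<open>c\<close> in the unit ball, stay at bounded distance:
  translating the first prefix by \<open>b\<close>, both are obtained by a meet and a join from arguments that
  are 5-close. The radius 5 arises since the exponents \<open>t - 2 k\<close> and \<open>t - 2 k'\<close> differ by at most 4
  and \<open>b\<close> contributes one more.\<close>
lemma fellow_traveller:
  assumes u: "u \<in> normal_forms" and v: "v \<in> normal_forms" and b: "b \<in> ball 1" and c: "c \<in> ball 1"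
    and eq: "b \<otimes> word_val G u \<otimes> c = word_val G v"
  shows "inv (word_val G (take t u)) \<otimes> inv b \<otimes> word_val G (take t v) \<in> ball 5"
proof -
  have "lists (insert (inv \<Delta>) simples) \<subseteq> lists (carrier G)"
    using simples_carrier by (intro lists_mono) simp
  then have listsC: "w \<in> lists (carrier G)" if "w \<in> normal_forms" for w
    using that by (auto simp: normal_forms_def)
  have take_listsC: "take t w \<in> lists (carrier G)" if "w \<in> normal_forms" for w
    using listsC[OF that] by (auto dest: in_set_takeD)
  have cl: "word_val G (take t u) \<in> carrier G" "word_val G (take t v) \<in> carrier G"
    "word_val G u \<in> carrier G" "b \<in> carrier G" "c \<in> carrier G"
    using word_val_closed listsC take_listsC u v b c ballD by blast+
  show ?thesis
  proof (cases "\<one> \<preceq> inv \<Delta>")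
    case True
    then show ?thesis using cl by (simp add: ball_eq_carrier)
  next
    case False
    let ?g = "word_val G u" and ?h = "word_val G v"
    let ?x = "word_val G (take t u)" and ?y = "word_val G (take t v)"
    obtain k q where k: "D (- int k) \<preceq> ?g" "k = 0 \<or> \<not> D (1 - int k) \<preceq> ?g"
      and q: "is_meet ?g (D (int t - 2 * int k)) q" "is_join q (D (- int t)) ?x"
      using normal_form_prefix[OF u False] by blast
    obtain k' q' where k': "D (- int k') \<preceq> ?h" "k' = 0 \<or> \<not> D (1 - int k') \<preceq> ?h"
      and q': "is_meet ?h (D (int t - 2 * int k')) q'" "is_join q' (D (- int t)) ?y"
      using normal_form_prefix[OF v False] by blast
    have "k' \<le> k + 2" using normal_form_exponent_close[OF b c k(1)] k'(2) eq by simp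
    moreover have "k \<le> k' + 2"
    proof (rule normal_form_exponent_close[OF ball_inv[OF b] ball_inv[OF c] k'(1)])
      have "inv b \<otimes> ?h \<otimes> inv c = ?g"
        using cl by (simp add: group_word_simps flip: eq)
      then show "k = 0 \<or> \<not> D (1 - int k) \<preceq> inv b \<otimes> ?h \<otimes> inv c" using k(2) by simp
    qed
    ultimately have kk: "int k' \<le> int k + 2" "int k \<le> int k' + 2" by auto
    have "b \<otimes> ?g \<otimes> D (- 5) \<preceq> ?h" "?h \<preceq> b \<otimes> ?g \<otimes> D 5"
      using close_mono[of "b \<otimes> ?g" 1 ?h 5] mult_ball_close[OF _ c, of "b \<otimes> ?g"] cl eq by auto
    moreover have "b \<otimes> D (int t - 2 * int k) \<otimes> D (- 5) \<preceq> D (int t - 2 * int k')"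
    proof -
      have "b \<otimes> D (int t - 2 * int k - 5) \<preceq> D (int t - 2 * int k - 5 + 1)"
        using ball_mult_D_close(2)[OF b, of "int t - 2 * int k - 5"] by simp
      also have "\<dots> \<preceq> D (int t - 2 * int k')" using kk by (intro D_mono) simp
      finally show ?thesis using cl by (simp add: mult_D_D)
    qed
    moreover have "D (int t - 2 * int k') \<preceq> b \<otimes> D (int t - 2 * int k) \<otimes> D 5"
    proof -
      have "D (int t - 2 * int k') \<preceq> D (int t - 2 * int k + 5 - 1)" using kk by (intro D_mono) simp
      also have "\<dots> \<preceq> b \<otimes> D (int t - 2 * int k + 5)" using ball_mult_D_close(1)[OF b, of "int t - 2 * int k + 5"] by simp
      finally show ?thesis using cl by (simp add: mult_D_D)
    qed
    ultimately have qq: "b \<otimes> q \<otimes> D (- 5) \<preceq> q'" "q' \<preceq> b \<otimes> q \<otimes> D 5"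
      using meet_close[OF is_meet_mult_left[OF q(1) cl(4)] q'(1)] by blast+
    have "b \<otimes> D (- int t) \<otimes> D (- 5) \<preceq> D (- int t)" "D (- int t) \<preceq> b \<otimes> D (- int t) \<otimes> D 5"
      using le_trans[OF ball_mult_D_close(2)[OF b] D_mono, of "- int t - 5" "- int t"]
        le_trans[OF D_mono ball_mult_D_close(1)[OF b], of "- int t" "- int t + 5"] cl
      by (simp_all add: mult_D_D)
    then have xy: "b \<otimes> ?x \<otimes> D (- 5) \<preceq> ?y" "?y \<preceq> b \<otimes> ?x \<otimes> D 5"
      using join_close[OF is_join_mult_left[OF q(2) cl(4)] q'(2)] qq by blast+
    have "inv (b \<otimes> ?x) \<otimes> (b \<otimes> ?x \<otimes> D (- 5)) \<preceq> inv (b \<otimes> ?x) \<otimes> ?y"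
      "inv (b \<otimes> ?x) \<otimes> ?y \<preceq> inv (b \<otimes> ?x) \<otimes> (b \<otimes> ?x \<otimes> D 5)"
      using xy cl by (auto intro!: le_mult_left)
    then show ?thesis using cl by (simp add: ball_def group_word_simps)
  qed
qed

text \<open>The generators are the simple elements and their inverses; all of them lie in the unit ball, so
  that the fellow traveller property applies to both multiplications.\<close>
lemma biautomatic_cone: "biautomatic G"
proof -
  define A where "A = simples \<union> (\<lambda>s. inv s) ` simples"
  have A: "finite A" "A \<subseteq> carrier G" using finite_simples simples_carrier by (auto simp: A_def)
  have "\<one> \<in> ball 1" using D_mono[of "- 1" 0] D_mono[of 0 1] by (simp add: ball_def)
  then have A1: "a \<in> ball 1" if "a \<in> insert \<one> A" for a
    using that simples_ball ball_inv unfolding A_def by blast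
  have one: "\<one> \<in> ball 1" using A1 by blast
  have inv_A: "inv a \<in> A" if "a \<in> A" for a
    using that simples_carrier by (auto simp: A_def)
  have sub: "insert (inv \<Delta>) simples \<subseteq> A" using Delta_simple by (auto simp: A_def)
  have reg: "regular_language A normal_forms"
    unfolding normal_forms_def using A(1) sub by (rule regular_language_successively)
  then have LA: "normal_forms \<subseteq> lists A" by (simp add: regular_language_def)
  have closed: "word_val G w \<in> carrier G" if "w \<in> normal_forms" for w
    using that LA A(2) by (intro word_val_closed) auto
  have "word_val G ` normal_forms = carrier G"
    using normal_form_exists closed by blast
  moreover have "generates_monoid G A"
    unfolding generates_monoid_def using A(2) normal_form_exists LA by blast
  moreover have "regular_language (pad_alphabet A) (right_multiplier G normal_forms a)"
    "regular_language (pad_alphabet A) (left_multiplier G normal_forms a)"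
    if "a \<in> insert \<one> A" for a
  proof -
    note a = A1[OF that]
    have ac: "a \<in> carrier G" using a ballD by blast
    have R: "right_multiplier G normal_forms a = {pad u v | u v. u \<in> normal_forms \<and>
        v \<in> normal_forms \<and> \<one> \<otimes> word_val G u \<otimes> a = word_val G v}"
      unfolding right_multiplier_def by (intro Collect_cong ex_cong1 conj_cong refl) (simp add: closed)
    have L: "left_multiplier G normal_forms a = {pad u v | u v. u \<in> normal_forms \<and>
        v \<in> normal_forms \<and> a \<otimes> word_val G u \<otimes> \<one> = word_val G v}"
      unfolding left_multiplier_def by (intro Collect_cong ex_cong1 conj_cong refl) (simp add: closed ac)
    show "regular_language (pad_alphabet A) (right_multiplier G normal_forms a)"
      unfolding R using fellow_traveller[OF _ _ one a] ac
      by (intro regular_multiplier[OF A reg finite_ball[of 5]]) auto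
    show "regular_language (pad_alphabet A) (left_multiplier G normal_forms a)"
      unfolding L using fellow_traveller[OF _ _ a one] ac
      by (intro regular_multiplier[OF A reg finite_ball[of 5]]) auto
  qed
  ultimately have "biautomatic_structure G A normal_forms"
    unfolding biautomatic_structure_def using A inv_A reg by blast
  then show ?thesis unfolding biautomatic_def using is_group by blast
qed

end

section \<open>Garside groups\<close>

text \<open>The order induced on the group by the image of the monoid restricts to left divisibility in the
  monoid.\<close>
lemma left_divides_iff_image:
  assumes M: "monoid M" and G: "group G" and \<iota>: "\<iota> \<in> hom M G" "inj_on \<iota> (carrier M)"
    and x: "x \<in> carrier M" and y: "y \<in> carrier M"
  shows "inv\<^bsub>G\<^esub> (\<iota> x) \<otimes>\<^bsub>G\<^esub> \<iota> y \<in> \<iota> ` carrier M \<longleftrightarrow> left_divides M x y"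
proof -
  interpret M: monoid M by fact
  interpret G: group G by fact
  have c: "\<iota> z \<in> carrier G" if "z \<in> carrier M" for z using \<iota>(1) that by (auto simp: hom_def)
  have mult: "\<iota> (a \<otimes>\<^bsub>M\<^esub> b) = \<iota> a \<otimes>\<^bsub>G\<^esub> \<iota> b" if "a \<in> carrier M" "b \<in> carrier M" for a b
    using \<iota>(1) that by (auto simp: hom_def)
  have "inv\<^bsub>G\<^esub> (\<iota> x) \<otimes>\<^bsub>G\<^esub> \<iota> y = \<iota> z \<longleftrightarrow> x \<otimes>\<^bsub>M\<^esub> z = y" if z: "z \<in> carrier M" for z
  proof -
    have "inv\<^bsub>G\<^esub> (\<iota> x) \<otimes>\<^bsub>G\<^esub> \<iota> y = \<iota> z \<longleftrightarrow> \<iota> y = \<iota> x \<otimes>\<^bsub>G\<^esub> \<iota> z"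
      using c x y z by (metis G.inv_solve_left)
    also have "\<dots> \<longleftrightarrow> x \<otimes>\<^bsub>M\<^esub> z = y"
      using mult[OF x z] inj_on_eq_iff[OF \<iota>(2), of y "x \<otimes>\<^bsub>M\<^esub> z"] x y z by auto
    finally show ?thesis .
  qed
  then show ?thesis unfolding left_divides_def by blast
qed

text \<open>A Garside element normalizes the monoid. For a divisor \<open>s\<close> of \<open>\<Delta>\<close>, completing twice as in
  \<open>s t = \<Delta> = t r\<close> gives \<open>s \<Delta> = \<Delta> r\<close>; this passes to products.\<close>
lemma garside_element_commute:
  assumes M: "monoid M" and \<Delta>: "garside_element M \<Delta>" and x: "x \<in> carrier M"
  shows "\<exists>y \<in> carrier M. x \<otimes>\<^bsub>M\<^esub> \<Delta> = \<Delta> \<otimes>\<^bsub>M\<^esub> y" "\<exists>y \<in> carrier M. \<Delta> \<otimes>\<^bsub>M\<^esub> x = y \<otimes>\<^bsub>M\<^esub> \<Delta>"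
proof -
  interpret M: monoid M by fact
  let ?S = "{x \<in> carrier M. left_divides M x \<Delta>}"
  have Dc: "\<Delta> \<in> carrier M" and LR: "?S = {x \<in> carrier M. right_divides M x \<Delta>}"
    and gen: "generates_monoid M ?S"
    using \<Delta> by (auto simp: garside_element_def)
  have left: "\<exists>z\<in>carrier M. s \<otimes>\<^bsub>M\<^esub> z = \<Delta>" if "s \<in> ?S" for s
    using that by (auto simp: left_divides_def)
  have right: "\<exists>z\<in>carrier M. z \<otimes>\<^bsub>M\<^esub> s = \<Delta>" if "s \<in> ?S" for s
  proof -
    have "s \<in> {x \<in> carrier M. right_divides M x \<Delta>}" using that LR by blast
    then show ?thesis by (auto simp: right_divides_def)
  qed
  have s1: "\<exists>y \<in> carrier M. s \<otimes>\<^bsub>M\<^esub> \<Delta> = \<Delta> \<otimes>\<^bsub>M\<^esub> y" if s: "s \<in> ?S" for s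
  proof -
    obtain t where t: "t \<in> carrier M" "s \<otimes>\<^bsub>M\<^esub> t = \<Delta>" using left[OF s] by blast
    then have "t \<in> {x \<in> carrier M. right_divides M x \<Delta>}"
      using s by (auto simp: right_divides_def)
    then have "t \<in> ?S" using LR by blast
    then obtain r where r: "r \<in> carrier M" "t \<otimes>\<^bsub>M\<^esub> r = \<Delta>" using left by blast
    have "s \<otimes>\<^bsub>M\<^esub> \<Delta> = (s \<otimes>\<^bsub>M\<^esub> t) \<otimes>\<^bsub>M\<^esub> r" using M.m_assoc[of s t r] s t r by simp
    then show ?thesis using r t by auto
  qed
  have s2: "\<exists>y \<in> carrier M. \<Delta> \<otimes>\<^bsub>M\<^esub> s = y \<otimes>\<^bsub>M\<^esub> \<Delta>" if s: "s \<in> ?S" for s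
  proof -
    obtain t where t: "t \<in> carrier M" "t \<otimes>\<^bsub>M\<^esub> s = \<Delta>" using right[OF s] by blast
    then have "t \<in> ?S" using s by (auto simp: left_divides_def)
    then obtain r where r: "r \<in> carrier M" "r \<otimes>\<^bsub>M\<^esub> t = \<Delta>" using right by blast
    have "\<Delta> \<otimes>\<^bsub>M\<^esub> s = r \<otimes>\<^bsub>M\<^esub> (t \<otimes>\<^bsub>M\<^esub> s)" using M.m_assoc[of r t s] s t r by simp
    then show ?thesis using r t by auto
  qed
  obtain w where w: "w \<in> lists ?S" "word_val M w = x"
    using gen x unfolding generates_monoid_def by blast
  have "word_val M w \<in> carrier M \<and> (\<exists>y \<in> carrier M. word_val M w \<otimes>\<^bsub>M\<^esub> \<Delta> = \<Delta> \<otimes>\<^bsub>M\<^esub> y) \<and>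
      (\<exists>y \<in> carrier M. \<Delta> \<otimes>\<^bsub>M\<^esub> word_val M w = y \<otimes>\<^bsub>M\<^esub> \<Delta>)"
    using w(1)
  proof (induction w)
    case Nil
    then show ?case using Dc by (auto intro: bexI[of _ "\<one>\<^bsub>M\<^esub>"])
  next
    case (Cons s w)
    let ?w = "word_val M w"
    have s: "s \<in> ?S" "s \<in> carrier M" using Cons.hyps by auto
    obtain y1 y2 where y: "?w \<in> carrier M" "y1 \<in> carrier M" "?w \<otimes>\<^bsub>M\<^esub> \<Delta> = \<Delta> \<otimes>\<^bsub>M\<^esub> y1"
      "y2 \<in> carrier M" "\<Delta> \<otimes>\<^bsub>M\<^esub> ?w = y2 \<otimes>\<^bsub>M\<^esub> \<Delta>"
      using Cons.IH by blast
    obtain z1 where z1: "z1 \<in> carrier M" "s \<otimes>\<^bsub>M\<^esub> \<Delta> = \<Delta> \<otimes>\<^bsub>M\<^esub> z1" using s1[OF s(1)] by blast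
    obtain z2 where z2: "z2 \<in> carrier M" "\<Delta> \<otimes>\<^bsub>M\<^esub> s = z2 \<otimes>\<^bsub>M\<^esub> \<Delta>" using s2[OF s(1)] by blast
    have "s \<otimes>\<^bsub>M\<^esub> ?w \<otimes>\<^bsub>M\<^esub> \<Delta> = s \<otimes>\<^bsub>M\<^esub> \<Delta> \<otimes>\<^bsub>M\<^esub> y1"
      using s y Dc by (simp add: M.m_assoc)
    also have "\<dots> = \<Delta> \<otimes>\<^bsub>M\<^esub> (z1 \<otimes>\<^bsub>M\<^esub> y1)" using z1 y Dc by (simp add: M.m_assoc)
    finally have 1: "s \<otimes>\<^bsub>M\<^esub> ?w \<otimes>\<^bsub>M\<^esub> \<Delta> = \<Delta> \<otimes>\<^bsub>M\<^esub> (z1 \<otimes>\<^bsub>M\<^esub> y1)" .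
    have "\<Delta> \<otimes>\<^bsub>M\<^esub> (s \<otimes>\<^bsub>M\<^esub> ?w) = \<Delta> \<otimes>\<^bsub>M\<^esub> s \<otimes>\<^bsub>M\<^esub> ?w"
      using s y Dc by (simp add: M.m_assoc)
    also have "\<dots> = z2 \<otimes>\<^bsub>M\<^esub> (\<Delta> \<otimes>\<^bsub>M\<^esub> ?w)" unfolding z2(2) using z2(1) y Dc by (simp add: M.m_assoc)
    also have "\<dots> = z2 \<otimes>\<^bsub>M\<^esub> y2 \<otimes>\<^bsub>M\<^esub> \<Delta>" unfolding y(5) using z2(1) y Dc by (simp add: M.m_assoc)
    finally have 2: "\<Delta> \<otimes>\<^bsub>M\<^esub> (s \<otimes>\<^bsub>M\<^esub> ?w) = z2 \<otimes>\<^bsub>M\<^esub> y2 \<otimes>\<^bsub>M\<^esub> \<Delta>" .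
    show ?case using 1 2 s y z1 z2 by auto
  qed
  then show "\<exists>y \<in> carrier M. x \<otimes>\<^bsub>M\<^esub> \<Delta> = \<Delta> \<otimes>\<^bsub>M\<^esub> y" "\<exists>y \<in> carrier M. \<Delta> \<otimes>\<^bsub>M\<^esub> x = y \<otimes>\<^bsub>M\<^esub> \<Delta>"
    using w(2) by auto
qed

theorem mainTheorem1:
  fixes G :: "('g, 'd) monoid_scheme"
  assumes "garside_group TYPE('m) G"
  shows "biautomatic G"
proof -
  obtain M :: "'m monoid" where "garside_monoid M" and frac: "group_of_fractions M G"
    using assms by (auto simp: garside_group_def)
  then obtain \<Delta> where gauss: "gaussian_monoid M" and \<Delta>: "garside_element M \<Delta>"
    by (auto simp: garside_monoid_def)
  have M: "monoid M" using gauss by (simp add: gaussian_monoid_def atomic_monoid_def)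
  have G: "group G" using frac by (simp add: group_of_fractions_def)
  obtain \<iota> where \<iota>: "\<iota> \<in> hom M G" "inj_on \<iota> (carrier M)"
    and fractions: "\<forall>g \<in> carrier G. \<exists>x \<in> carrier M. \<exists>y \<in> carrier M. g = inv\<^bsub>G\<^esub> (\<iota> x) \<otimes>\<^bsub>G\<^esub> \<iota> y"
    using frac by (auto simp: group_of_fractions_def)
  interpret M: monoid M by fact
  interpret G: group G by fact
  have c: "\<iota> z \<in> carrier G" if "z \<in> carrier M" for z using \<iota>(1) that by (auto simp: hom_def)
  have mult: "\<iota> (a \<otimes>\<^bsub>M\<^esub> b) = \<iota> a \<otimes>\<^bsub>G\<^esub> \<iota> b" if "a \<in> carrier M" "b \<in> carrier M" for a b
    using \<iota>(1) that by (auto simp: hom_def)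
  have one: "\<iota> \<one>\<^bsub>M\<^esub> = \<one>\<^bsub>G\<^esub>"
    using mult[of "\<one>\<^bsub>M\<^esub>" "\<one>\<^bsub>M\<^esub>"] c[of "\<one>\<^bsub>M\<^esub>"] G.r_cancel_one'[of "\<iota> \<one>\<^bsub>M\<^esub>" "\<iota> \<one>\<^bsub>M\<^esub>"] by simp
  note div = left_divides_iff_image[OF M G \<iota>]
  have Dc: "\<Delta> \<in> carrier M" using \<Delta> by (simp add: garside_element_def)
  let ?P = "\<iota> ` carrier M"
  let ?S = "{x \<in> carrier M. left_divides M x \<Delta>}"
  have simples: "{s \<in> ?P. inv\<^bsub>G\<^esub> s \<otimes>\<^bsub>G\<^esub> \<iota> \<Delta> \<in> ?P} = \<iota> ` ?S"
    using div[OF _ Dc] by blast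
  interpret garside_cone G ?P "\<iota> \<Delta>"
  proof
    show "?P \<subseteq> carrier G" using c by blast
    show "\<one>\<^bsub>G\<^esub> \<in> ?P" using one M.one_closed by (metis imageI)
    show "x \<otimes>\<^bsub>G\<^esub> y \<in> ?P" if "x \<in> ?P" "y \<in> ?P" for x y
      using that by (auto simp flip: mult)
    show "\<iota> \<Delta> \<in> ?P" using Dc by blast
    show "inv\<^bsub>G\<^esub> (\<iota> \<Delta>) \<otimes>\<^bsub>G\<^esub> x \<otimes>\<^bsub>G\<^esub> \<iota> \<Delta> \<in> ?P" if x: "x \<in> ?P" for x
    proof -
      obtain a where a: "a \<in> carrier M" "x = \<iota> a" using x by blast
      obtain b where b: "b \<in> carrier M" "a \<otimes>\<^bsub>M\<^esub> \<Delta> = \<Delta> \<otimes>\<^bsub>M\<^esub> b"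
        using garside_element_commute(1)[OF M \<Delta> a(1)] by blast
      have "\<iota> a \<otimes>\<^bsub>G\<^esub> \<iota> \<Delta> = \<iota> \<Delta> \<otimes>\<^bsub>G\<^esub> \<iota> b" using a b Dc by (simp flip: mult)
      then have "inv\<^bsub>G\<^esub> (\<iota> \<Delta>) \<otimes>\<^bsub>G\<^esub> x \<otimes>\<^bsub>G\<^esub> \<iota> \<Delta> = \<iota> b"
        using a b Dc c by (simp add: G.m_assoc G.inv_mult_cancel)
      then show ?thesis using b by blast
    qed
    show "\<iota> \<Delta> \<otimes>\<^bsub>G\<^esub> x \<otimes>\<^bsub>G\<^esub> inv\<^bsub>G\<^esub> (\<iota> \<Delta>) \<in> ?P" if x: "x \<in> ?P" for x
    proof -
      obtain a where a: "a \<in> carrier M" "x = \<iota> a" using x by blast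
      obtain b where b: "b \<in> carrier M" "\<Delta> \<otimes>\<^bsub>M\<^esub> a = b \<otimes>\<^bsub>M\<^esub> \<Delta>"
        using garside_element_commute(2)[OF M \<Delta> a(1)] by blast
      have "\<iota> \<Delta> \<otimes>\<^bsub>G\<^esub> \<iota> a = \<iota> b \<otimes>\<^bsub>G\<^esub> \<iota> \<Delta>" using a b Dc by (simp flip: mult)
      then have "\<iota> \<Delta> \<otimes>\<^bsub>G\<^esub> x \<otimes>\<^bsub>G\<^esub> inv\<^bsub>G\<^esub> (\<iota> \<Delta>) = \<iota> b"
        using a b Dc c by (simp add: G.m_assoc)
      then show ?thesis using b by blast
    qed
    show "finite {s \<in> ?P. inv\<^bsub>G\<^esub> s \<otimes>\<^bsub>G\<^esub> \<iota> \<Delta> \<in> ?P}"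
      unfolding simples using \<Delta> unfolding garside_element_def by blast
    show "\<exists>w \<in> lists {s \<in> ?P. inv\<^bsub>G\<^esub> s \<otimes>\<^bsub>G\<^esub> \<iota> \<Delta> \<in> ?P}. word_val G w = x" if x: "x \<in> ?P" for x
    proof -
      obtain a where a: "a \<in> carrier M" "x = \<iota> a" using x by blast
      have "generates_monoid M ?S" using \<Delta> unfolding garside_element_def by blast
      then obtain w where w: "w \<in> lists ?S" "word_val M w = a"
        using a unfolding generates_monoid_def by blast
      have "word_val M w \<in> carrier M \<and> word_val G (map \<iota> w) = \<iota> (word_val M w)"
        using w(1) by (induction w) (auto simp: one mult)
      moreover have "map \<iota> w \<in> lists (\<iota> ` ?S)" using w(1) by auto
      ultimately show ?thesis unfolding simples using w(2) a(2) by blast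
    qed
    show "\<exists>x \<in> ?P. \<exists>y \<in> ?P. g = inv\<^bsub>G\<^esub> x \<otimes>\<^bsub>G\<^esub> y" if "g \<in> carrier G" for g
      using fractions that by blast
    show "\<exists>d \<in> ?P. inv\<^bsub>G\<^esub> d \<otimes>\<^bsub>G\<^esub> x \<in> ?P \<and> inv\<^bsub>G\<^esub> d \<otimes>\<^bsub>G\<^esub> y \<in> ?P \<and>
        (\<forall>e \<in> ?P. inv\<^bsub>G\<^esub> e \<otimes>\<^bsub>G\<^esub> x \<in> ?P \<longrightarrow> inv\<^bsub>G\<^esub> e \<otimes>\<^bsub>G\<^esub> y \<in> ?P \<longrightarrow> inv\<^bsub>G\<^esub> e \<otimes>\<^bsub>G\<^esub> d \<in> ?P)"
      if xy: "x \<in> ?P" "y \<in> ?P" for x y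
    proof -
      obtain a b where ab: "a \<in> carrier M" "x = \<iota> a" "b \<in> carrier M" "y = \<iota> b"
        using xy by blast
      obtain d where d: "is_left_gcd M a b d"
        using gauss ab unfolding gaussian_monoid_def by blast
      then have dc: "d \<in> carrier M" by (simp add: is_left_gcd_def)
      show ?thesis
      proof (intro bexI[of _ "\<iota> d"] conjI ballI impI)
        show "inv\<^bsub>G\<^esub> (\<iota> d) \<otimes>\<^bsub>G\<^esub> x \<in> ?P" "inv\<^bsub>G\<^esub> (\<iota> d) \<otimes>\<^bsub>G\<^esub> y \<in> ?P"
          using d dc ab div by (simp_all add: is_left_gcd_def)
        show "inv\<^bsub>G\<^esub> e \<otimes>\<^bsub>G\<^esub> \<iota> d \<in> ?P"
          if e: "e \<in> ?P" "inv\<^bsub>G\<^esub> e \<otimes>\<^bsub>G\<^esub> x \<in> ?P" "inv\<^bsub>G\<^esub> e \<otimes>\<^bsub>G\<^esub> y \<in> ?P" for e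
        proof -
          obtain f where f: "f \<in> carrier M" "e = \<iota> f" using e(1) by blast
          then show ?thesis using e(2,3) d dc ab div by (simp add: is_left_gcd_def)
        qed
      qed (use dc in blast)
    qed
  qed
  show ?thesis by (rule biautomatic_cone)
qed

end
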